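(* Let $\mathbf k$ be a field of characteristic $0$, $\lambda\in\mathbf k$, let $V$ be a vector space and $d_V\in\mathrm{End}_{\mathbf k}(V)$. Then abelian extensions of a differential Lie algebra $(\mathfrak g,d_{\mathfrak g})$ of weight $\lambda$ by $(V,d_V)$ are classified by the second cohomology group $\tilde{\mathrm H}^2_{\mathrm{DL}_\lambda}(\mathfrak g,V)$ of $(\mathfrak g,d_{\mathfrak g})$ with coefficients in the representation $(V,d_V)$.
   Context: A differential Lie algebra of weight $\lambda$ is a Lie algebra $\mathfrak g$ with a linear map $d_{\mathfrak g}:\mathfrak g\to\mathfrak g$ such that $d_{\mathfrak g}([x,y])=[d_{\mathfrak g}(x),y]+[x,d_{\mathfrak g}(y)]+\lambda[d_{\mathfrak g}(x),d_{\mathfrak g}(y)]$; homomorphisms are Lie algebra homomorphisms commuting with the operators. $(V,d_V)$ is regarded as a differential Lie algebra with zero bracket. An abelian extension of $(\mathfrak g,d_{\mathfrak g})$ by $(V,d_V)$ is a short exact sequence of homomorphisms of differential Lie algebras $0\to(V,d_V)\xrightarrow{i}(\hat{\mathfrak g},d_{\hat{\mathfrak g}})\xrightarrow{p}(\mathfrak g,d_{\mathfrak g})\to0$. Two abelian extensions are isomorphic if there is an isomorphism of differential Lie algebras between the middle terms that is compatible with the maps $i$ and $p$ (with the identity on $V$ and on $\mathfrak g$). A section is a linear map $s:\mathfrak g\to\hat{\mathfrak g}$ with $p\circ s=\mathrm{Id}_{\mathfrak g}$. Identifying $V$ with $i(V)$, an abelian extension with a section $s$ induces on $V$ the representation $\rho(x)v=[s(x),v]_{\hat{\mathfrak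 g}}$. A representation of $(\mathfrak g,d_{\mathfrak g})$ is $(V,\rho,d_V)$ (also written $(V,d_V)$) with $(V,\rho)$ a representation of the Lie algebra $\mathfrak g$ and $d_V(\rho(x)v)=\rho(d_{\mathfrak g}(x))v+\rho(x)d_V(v)+\lambda\rho(d_{\mathfrak g}(x))d_V(v)$. Put $\rho_\lambda(x)=\rho(x+\lambda d_{\mathfrak g}(x))$. For $f\in\mathrm{Hom}(\wedge^n\mathfrak g,V)$, $$\partial^n_{\mathrm{Lie}}(f)(x_1,\dots,x_{n+1})=\sum_{i}(-1)^{i+n}\rho(x_i)f(x_1,\dots,\hat x_i,\dots,x_{n+1})+\sum_{i<j}(-1)^{i+j+n+1}f([x_i,x_j],x_1,\dots,\hat x_i,\dots,\hat x_j,\dots,x_{n+1}),$$ $\partial^n_{\mathrm{DO}_\lambda}$ is the same with $\rho_\lambda$ in place of $\rho$, and $$\delta^nf(x_1,\dots,x_n)=\sum_{k=1}^n\lambda^{k-1}\sum_{i_1<\dots<i_k}f(x_1,\dots,d_{\mathfrak g}(x_{i_1}),\dots,d_{\mathfrak g}(x_{i_k}),\dots,x_n)-d_Vf(x_1,\dots,x_n).$$ The complex $\tilde{\mathrm C}^*_{\mathrm{DL}_\lambda}(\mathfrak g,V)$ is $0$ in degree $0$, $\mathrm{Hom}(\mathfrak g,V)$ in degree $1$, and $\mathrm{Hom}(\wedge^n\mathfrak g,V)\oplus\mathrm{Hom}(\wedge^{n-1}\mathfrak g,V)$ in degree $n\ge2$, with differential $\partial^n_{\mathrm{DL}_\lambda}(f,g)=(\partial^n_{\mathrm{Lie}}f,-\partial^{n-1}_{\mathrm{DO}_\lambda}g-\delta^nf)$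 (with $g=0$ when $n=1$). Its cohomology is $\tilde{\mathrm H}^*_{\mathrm{DL}_\lambda}(\mathfrak g,V)$. *)

theory Defs
  imports Complex_Main "HOL-Library.Function_Algebras" "HOL-Library.Product_Plus"
begin

locale lie_algebra = vector_space scale
  for scale :: "'k::field \<Rightarrow> 'a::ab_group_add \<Rightarrow> 'a" +
  fixes bracket :: "'a \<Rightarrow> 'a \<Rightarrow> 'a"
  assumes linear_left: "Vector_Spaces.linear scale scale (\<lambda>x. bracket x y)"
    and linear_right: "Vector_Spaces.linear scale scale (\<lambda>y. bracket x y)"
    and bracket_self: "bracket x x = 0"
    and jacobi: "bracket x (bracket y z) + bracket y (bracket z x) + bracket z (bracket x y) = 0"

record ('k, 'a) diff_lie =
  scl :: "'k \<Rightarrow> 'a \<Rightarrow> 'a"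
  brk :: "'a \<Rightarrow> 'a \<Rightarrow> 'a"
  der :: "'a \<Rightarrow> 'a"

definition diff_lie_algebra :: "'k::field \<Rightarrow> ('k, 'a::ab_group_add) diff_lie \<Rightarrow> bool" where
  "diff_lie_algebra lam L \<longleftrightarrow>
     lie_algebra (scl L) (brk L) \<and>
     Vector_Spaces.linear (scl L) (scl L) (der L) \<and>
     (\<forall>x y. der L (brk L x y) =
        brk L (der L x) y + brk L x (der L y) + scl L lam (brk L (der L x) (der L y)))"

definition diff_lie_hom ::
  "('k::field, 'a::ab_group_add) diff_lie \<Rightarrow> ('k, 'b::ab_group_add) diff_lie \<Rightarrow> ('a \<Rightarrow> 'b) \<Rightarrow> bool" where
  "diff_lie_hom L M f \<longleftrightarrow>
     Vector_Spaces.linear (scl L) (scl M) f \<and>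
     (\<forall>x y. f (brk L x y) = brk M (f x) (f y)) \<and>
     (\<forall>x. f (der L x) = der M (f x))"

definition trivial_diff_lie ::
  "('k \<Rightarrow> 'v::ab_group_add \<Rightarrow> 'v) \<Rightarrow> ('v \<Rightarrow> 'v) \<Rightarrow> ('k, 'v) diff_lie" where
  "trivial_diff_lie sV dV = \<lparr>scl = sV, brk = (\<lambda>_ _. 0), der = dV\<rparr>"

definition diff_representation ::
  "'k::field \<Rightarrow> ('k, 'g::ab_group_add) diff_lie \<Rightarrow> ('k \<Rightarrow> 'v::ab_group_add \<Rightarrow> 'v) \<Rightarrow> ('v \<Rightarrow> 'v) \<Rightarrow>
    ('g \<Rightarrow> 'v \<Rightarrow> 'v) \<Rightarrow> bool" where
  "diff_representation lam G sV dV \<rho> \<longleftrightarrow>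
     (\<forall>x. Vector_Spaces.linear sV sV (\<rho> x)) \<and>
     (\<forall>v. Vector_Spaces.linear (scl G) sV (\<lambda>x. \<rho> x v)) \<and>
     (\<forall>x y v. \<rho> (brk G x y) v = \<rho> x (\<rho> y v) - \<rho> y (\<rho> x v)) \<and>
     Vector_Spaces.linear sV sV dV \<and>
     (\<forall>x v. dV (\<rho> x v) = \<rho> (der G x) v + \<rho> x (dV v) + sV lam (\<rho> (der G x) (dV v)))"


section \<open>Abelian extensions\<close>

text \<open>
  The middle term of an extension lives on a whole type \<open>'e\<close>; its scalar multiplication is
  part of the data, its addition is the one of the type.
\<close>

record ('k, 'v, 'g, 'e) extension =
  mid :: "('k, 'e) diff_lie"
  inc :: "'v \<Rightarrow> 'e"
  prj :: "'e \<Rightarrow> 'g"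

definition abelian_extension ::
  "'k::field \<Rightarrow> ('k, 'g::ab_group_add) diff_lie \<Rightarrow> ('k \<Rightarrow> 'v::ab_group_add \<Rightarrow> 'v) \<Rightarrow> ('v \<Rightarrow> 'v) \<Rightarrow>
    ('k, 'v, 'g, 'e::ab_group_add) extension \<Rightarrow> bool" where
  "abelian_extension lam G sV dV E \<longleftrightarrow>
     diff_lie_algebra lam (mid E) \<and>
     diff_lie_hom (trivial_diff_lie sV dV) (mid E) (inc E) \<and>
     diff_lie_hom (mid E) G (prj E) \<and>
     inj (inc E) \<and> range (inc E) = {e. prj E e = 0} \<and> surj (prj E)"

definition ext_iso ::
  "('k::field, 'v, 'g, 'e::ab_group_add) extension \<Rightarrow> ('k, 'v, 'g, 'f::ab_group_add) extension \<Rightarrow> bool" where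
  "ext_iso E F \<longleftrightarrow>
     (\<exists>\<phi>. diff_lie_hom (mid E) (mid F) \<phi> \<and> bij \<phi> \<and>
          \<phi> \<circ> inc E = inc F \<and> prj F \<circ> \<phi> = prj E)"

definition is_section ::
  "('k::field, 'g::ab_group_add) diff_lie \<Rightarrow> ('k, 'v, 'g, 'e::ab_group_add) extension \<Rightarrow> ('g \<Rightarrow> 'e) \<Rightarrow> bool" where
  "is_section G E s \<longleftrightarrow> Vector_Spaces.linear (scl G) (scl (mid E)) s \<and> prj E \<circ> s = id"

definition induced_action ::
  "('k, 'v, 'g, 'e) extension \<Rightarrow> ('g \<Rightarrow> 'e) \<Rightarrow> 'g \<Rightarrow> 'v \<Rightarrow> 'v" where
  "induced_action E s x v = inv (inc E) (brk (mid E) (s x) (inc E v))"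

definition induces ::
  "('k::field, 'g::ab_group_add) diff_lie \<Rightarrow> ('k, 'v, 'g, 'e::ab_group_add) extension \<Rightarrow>
    ('g \<Rightarrow> 'v \<Rightarrow> 'v) \<Rightarrow> bool" where
  "induces G E \<rho> \<longleftrightarrow> (\<exists>s. is_section G E s \<and> induced_action E s = \<rho>)"

definition extensions_inducing ::
  "'k::field \<Rightarrow> ('k, 'g::ab_group_add) diff_lie \<Rightarrow> ('k \<Rightarrow> 'v::ab_group_add \<Rightarrow> 'v) \<Rightarrow> ('v \<Rightarrow> 'v) \<Rightarrow>
    ('g \<Rightarrow> 'v \<Rightarrow> 'v) \<Rightarrow> ('k, 'v, 'g, 'e::ab_group_add) extension set" where
  "extensions_inducing lam G sV dV \<rho> = {E. abelian_extension lam G sV dV E \<and> induces G E \<rho>}"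

definition ext_iso_rel ::
  "('k::field, 'v, 'g, 'e::ab_group_add) extension set \<Rightarrow>
    (('k, 'v, 'g, 'e) extension \<times> ('k, 'v, 'g, 'e) extension) set" where
  "ext_iso_rel A = {(E, F). E \<in> A \<and> F \<in> A \<and> ext_iso E F}"


section \<open>The cochain complex\<close>

text \<open>
  An element of \<open>Hom(\<And>\<^sup>n g, V)\<close> is an alternating multilinear function of lists of length
  \<open>n\<close>, extended by \<open>0\<close> to all other lists so that equality of cochains is equality of
  functions.  List positions start at \<open>0\<close>, the indices of the usual formulas at \<open>1\<close>; this is
  the reason for the successors in the signs below.
\<close>

definition alt_maps ::
  "('k::field \<Rightarrow> 'g::ab_group_add \<Rightarrow> 'g) \<Rightarrow> ('k \<Rightarrow> 'v::ab_group_add \<Rightarrow> 'v) \<Rightarrow> nat \<Rightarrow>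
    ('g list \<Rightarrow> 'v) set" where
  "alt_maps sG sV n = {f.
     (\<forall>xs. length xs \<noteq> n \<longrightarrow> f xs = 0) \<and>
     (\<forall>xs i. length xs = n \<longrightarrow> i < n \<longrightarrow> Vector_Spaces.linear sG sV (\<lambda>x. f (xs[i := x]))) \<and>
     (\<forall>xs i j. length xs = n \<longrightarrow> i < j \<longrightarrow> j < n \<longrightarrow> xs ! i = xs ! j \<longrightarrow> f xs = 0)}"

definition omit :: "nat \<Rightarrow> 'a list \<Rightarrow> 'a list" where
  "omit i xs = take i xs @ drop (Suc i) xs"

definition d_Lie ::
  "('k::field, 'g::ab_group_add) diff_lie \<Rightarrow> ('k \<Rightarrow> 'v::ab_group_add \<Rightarrow> 'v) \<Rightarrow> ('g \<Rightarrow> 'v \<Rightarrow> 'v) \<Rightarrow>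
    nat \<Rightarrow> ('g list \<Rightarrow> 'v) \<Rightarrow> 'g list \<Rightarrow> 'v" where
  "d_Lie G sV \<rho> n f xs =
     (if length xs = n + 1 then
        (\<Sum>i<n+1. sV ((- 1) ^ (Suc i + n)) (\<rho> (xs ! i) (f (omit i xs)))) +
        (\<Sum>j<n+1. \<Sum>i<j. sV ((- 1) ^ (Suc i + Suc j + n + 1))
            (f (brk G (xs ! i) (xs ! j) # omit i (omit j xs))))
      else 0)"

definition rho_weighted ::
  "'k::field \<Rightarrow> ('k, 'g::ab_group_add) diff_lie \<Rightarrow> ('g \<Rightarrow> 'v \<Rightarrow> 'v) \<Rightarrow> 'g \<Rightarrow> 'v \<Rightarrow> 'v" where
  "rho_weighted lam G \<rho> x = \<rho> (x + scl G lam (der G x))"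

definition d_DO ::
  "'k::field \<Rightarrow> ('k, 'g::ab_group_add) diff_lie \<Rightarrow> ('k \<Rightarrow> 'v::ab_group_add \<Rightarrow> 'v) \<Rightarrow> ('g \<Rightarrow> 'v \<Rightarrow> 'v) \<Rightarrow>
    nat \<Rightarrow> ('g list \<Rightarrow> 'v) \<Rightarrow> 'g list \<Rightarrow> 'v" where
  "d_DO lam G sV \<rho> = d_Lie G sV (rho_weighted lam G \<rho>)"

definition delta ::
  "'k::field \<Rightarrow> ('k, 'g::ab_group_add) diff_lie \<Rightarrow> ('k \<Rightarrow> 'v::ab_group_add \<Rightarrow> 'v) \<Rightarrow> ('v \<Rightarrow> 'v) \<Rightarrow>
    nat \<Rightarrow> ('g list \<Rightarrow> 'v) \<Rightarrow> 'g list \<Rightarrow> 'v" where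
  "delta lam G sV dV n f xs =
     (if length xs = n then
        (\<Sum>k=1..n. sV (lam ^ (k - 1))
           (\<Sum>I | I \<subseteq> {..<n} \<and> card I = k.
              f (map (\<lambda>i. if i \<in> I then der G (xs ! i) else xs ! i) [0..<n])))
        - dV (f xs)
      else 0)"

definition DL_cochains ::
  "('k::field, 'g::ab_group_add) diff_lie \<Rightarrow> ('k \<Rightarrow> 'v::ab_group_add \<Rightarrow> 'v) \<Rightarrow> nat \<Rightarrow>
    (('g list \<Rightarrow> 'v) \<times> ('g list \<Rightarrow> 'v)) set" where
  "DL_cochains G sV n =
     (if n = 0 then {0}
      else if n = 1 then alt_maps (scl G) sV 1 \<times> {0}
      else alt_maps (scl G) sV n \<times> alt_maps (scl G) sV (n - 1))"

definition d_DL ::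
  "'k::field \<Rightarrow> ('k, 'g::ab_group_add) diff_lie \<Rightarrow> ('k \<Rightarrow> 'v::ab_group_add \<Rightarrow> 'v) \<Rightarrow> ('v \<Rightarrow> 'v) \<Rightarrow>
    ('g \<Rightarrow> 'v \<Rightarrow> 'v) \<Rightarrow> nat \<Rightarrow> ('g list \<Rightarrow> 'v) \<times> ('g list \<Rightarrow> 'v) \<Rightarrow>
    ('g list \<Rightarrow> 'v) \<times> ('g list \<Rightarrow> 'v)" where
  "d_DL lam G sV dV \<rho> n c =
     (d_Lie G sV \<rho> n (fst c),
      \<lambda>xs. - d_DO lam G sV \<rho> (n - 1) (snd c) xs - delta lam G sV dV n (fst c) xs)"

definition DL_cocycles ::
  "'k::field \<Rightarrow> ('k, 'g::ab_group_add) diff_lie \<Rightarrow> ('k \<Rightarrow> 'v::ab_group_add \<Rightarrow> 'v) \<Rightarrow> ('v \<Rightarrow> 'v) \<Rightarrow>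
    ('g \<Rightarrow> 'v \<Rightarrow> 'v) \<Rightarrow> nat \<Rightarrow> (('g list \<Rightarrow> 'v) \<times> ('g list \<Rightarrow> 'v)) set" where
  "DL_cocycles lam G sV dV \<rho> n = {c \<in> DL_cochains G sV n. d_DL lam G sV dV \<rho> n c = 0}"

definition DL_coboundaries ::
  "'k::field \<Rightarrow> ('k, 'g::ab_group_add) diff_lie \<Rightarrow> ('k \<Rightarrow> 'v::ab_group_add \<Rightarrow> 'v) \<Rightarrow> ('v \<Rightarrow> 'v) \<Rightarrow>
    ('g \<Rightarrow> 'v \<Rightarrow> 'v) \<Rightarrow> nat \<Rightarrow> (('g list \<Rightarrow> 'v) \<times> ('g list \<Rightarrow> 'v)) set" where
  "DL_coboundaries lam G sV dV \<rho> n =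
     (if n = 0 then {0} else d_DL lam G sV dV \<rho> (n - 1) ` DL_cochains G sV (n - 1))"

definition DL_cohomologous ::
  "'k::field \<Rightarrow> ('k, 'g::ab_group_add) diff_lie \<Rightarrow> ('k \<Rightarrow> 'v::ab_group_add \<Rightarrow> 'v) \<Rightarrow> ('v \<Rightarrow> 'v) \<Rightarrow>
    ('g \<Rightarrow> 'v \<Rightarrow> 'v) \<Rightarrow> nat \<Rightarrow>
    ((('g list \<Rightarrow> 'v) \<times> ('g list \<Rightarrow> 'v)) \<times> (('g list \<Rightarrow> 'v) \<times> ('g list \<Rightarrow> 'v))) set" where
  "DL_cohomologous lam G sV dV \<rho> n =
     {(a, b). a \<in> DL_cocycles lam G sV dV \<rho> n \<and> b \<in> DL_cocycles lam G sV dV \<rho> n \<and>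
        a - b \<in> DL_coboundaries lam G sV dV \<rho> n}"

definition DL_cohomology ::
  "'k::field \<Rightarrow> ('k, 'g::ab_group_add) diff_lie \<Rightarrow> ('k \<Rightarrow> 'v::ab_group_add \<Rightarrow> 'v) \<Rightarrow> ('v \<Rightarrow> 'v) \<Rightarrow>
    ('g \<Rightarrow> 'v \<Rightarrow> 'v) \<Rightarrow> nat \<Rightarrow> (('g list \<Rightarrow> 'v) \<times> ('g list \<Rightarrow> 'v)) set set" where
  "DL_cohomology lam G sV dV \<rho> n =
     DL_cocycles lam G sV dV \<rho> n // DL_cohomologous lam G sV dV \<rho> n"


section \<open>The cohomology class of an extension\<close>

text \<open>
  Under the identification of \<open>V\<close> with \<open>i(V)\<close>, a section \<open>s\<close> gives the pair of
  \<open>\<psi>(x,y) = [s(x), s(y)] - s([x,y])\<close> and \<open>\<chi>(x) = d(s(x)) - s(d(x))\<close>.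
\<close>

definition ext_cocycle ::
  "('k::field, 'g::ab_group_add) diff_lie \<Rightarrow> ('k, 'v::ab_group_add, 'g, 'e::ab_group_add) extension \<Rightarrow>
    ('g \<Rightarrow> 'e) \<Rightarrow> ('g list \<Rightarrow> 'v) \<times> ('g list \<Rightarrow> 'v)" where
  "ext_cocycle G E s =
     (\<lambda>xs. case xs of
         [x, y] \<Rightarrow> inv (inc E) (brk (mid E) (s x) (s y) - s (brk G x y))
       | _ \<Rightarrow> 0,
      \<lambda>xs. case xs of
         [x] \<Rightarrow> inv (inc E) (der (mid E) (s x) - s (der G x))
       | _ \<Rightarrow> 0)"

definition ext_class ::
  "'k::field \<Rightarrow> ('k, 'g::ab_group_add) diff_lie \<Rightarrow> ('k \<Rightarrow> 'v::ab_group_add \<Rightarrow> 'v) \<Rightarrow> ('v \<Rightarrow> 'v) \<Rightarrow>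
    ('g \<Rightarrow> 'v \<Rightarrow> 'v) \<Rightarrow> ('k, 'v, 'g, 'e::ab_group_add) extension \<Rightarrow>
    (('g list \<Rightarrow> 'v) \<times> ('g list \<Rightarrow> 'v)) set" where
  "ext_class lam G sV dV \<rho> E =
     DL_cohomologous lam G sV dV \<rho> 2 `` {ext_cocycle G E (SOME s. is_section G E s)}"

end

theory Submission imports Defs begin

text \<open>
  Relative to a linear section \<open>s\<close>, every element of the middle term is uniquely \<open>i(v) + s(x)\<close>, and
  the Jacobi identity and the Leibniz rule of weight \<open>\<lambda>\<close> for the elements \<open>s(x)\<close> are exactly the
  two components of the cocycle condition for \<open>(\<psi>, \<chi>)\<close>.  Replacing \<open>s\<close> by \<open>s + i \<circ> f\<close> keeps the
  action and adds the coboundary of \<open>f\<close>, so cohomologous extensions possess sections with equal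
  cocycles, and both are then isomorphic to the twisted product \<open>V \<times> g\<close> of that cocycle.
\<close>

section \<open>Low-degree cochains\<close>

text \<open>An extension comes without a representation: it produces \<open>\<rho>\<close> only
  through a section, so the action must first be shown independent of that section. This and most
  later cancellations have one source: i(V) has zero bracket, so every bracket of two elements of
  i(V) disappears. A second obstacle is that middle terms live on arbitrary types, and no single set
  can range over all of them. Extensions with different carriers are therefore compared through
  their cohomology classes, and \<open>'v \<times> 'g\<close> serves as a common carrier on which
  each extension inducing \<open>\<rho>\<close> has an isomorphic copy.\<close>

lemmas linear_simps =
  module_hom.add[OF module_hom_linearI] module_hom.scale[OF module_hom_linearI]
  module_hom.zero[OF module_hom_linearI] module_hom.neg[OF module_hom_linearI]
  module_hom.diff[OF module_hom_linearI]

text \<open>Cochains are functions of lists; \<open>cochain1\<close> and \<open>cochain2\<close>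
  allow all later calculations to run with curried functions. The default 0 is the value that
  \<open>alt_maps\<close> demands on lists of the wrong length.\<close>

definition cochain1 :: "('g \<Rightarrow> 'v::zero) \<Rightarrow> 'g list \<Rightarrow> 'v" where
  "cochain1 \<chi> xs = (case xs of [x] \<Rightarrow> \<chi> x | _ \<Rightarrow> 0)"

definition cochain2 :: "('g \<Rightarrow> 'g \<Rightarrow> 'v::zero) \<Rightarrow> 'g list \<Rightarrow> 'v" where
  "cochain2 \<psi> xs = (case xs of [x, y] \<Rightarrow> \<psi> x y | _ \<Rightarrow> 0)"

lemma cochain1_simps [simp]:
  "cochain1 \<chi> [x] = \<chi> x" "length xs \<noteq> 1 \<Longrightarrow> cochain1 \<chi> xs = 0"
  by (auto simp: cochain1_def split: list.split)

lemma cochain2_simps [simp]: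
  "cochain2 \<psi> [x, y] = \<psi> x y" "length xs \<noteq> 2 \<Longrightarrow> cochain2 \<psi> xs = 0"
  by (auto simp: cochain2_def split: list.split)

lemma length_eq_2: "length xs = 2 \<longleftrightarrow> (\<exists>x y. xs = [x, y])"
  by (auto simp: numeral_2_eq_2 length_Suc_conv)

lemma length_eq_3: "length xs = 3 \<longleftrightarrow> (\<exists>x y z. xs = [x, y, z])"
  by (auto simp: numeral_3_eq_3 length_Suc_conv)

lemma length_eq_1: "length xs = Suc 0 \<longleftrightarrow> (\<exists>x. xs = [x])"
  by (auto simp: length_Suc_conv)

lemma cochain1_eqI:
  assumes "\<And>x. f [x] = g [x]" "\<And>xs. length xs \<noteq> 1 \<Longrightarrow> f xs = g xs"
  shows "f = g"
  using assms by (metis ext length_eq_1 One_nat_def)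

lemma cochain2_eqI:
  assumes "\<And>x y. f [x, y] = g [x, y]" "\<And>xs. length xs \<noteq> 2 \<Longrightarrow> f xs = g xs"
  shows "f = g"
  using assms by (metis ext length_eq_2)

lemma cochain1_inject [simp]: "cochain1 f = cochain1 g \<longleftrightarrow> f = g"
  by (metis cochain1_simps(1) ext)

lemma cochain2_inject [simp]: "cochain2 f = cochain2 g \<longleftrightarrow> f = g"
  by (metis cochain2_simps(1) ext)

lemma cochain1_diff: "cochain1 f - cochain1 g = cochain1 (\<lambda>x. f x - g x :: 'v::ab_group_add)"
  by (rule cochain1_eqI) auto

lemma cochain2_diff: "cochain2 f - cochain2 g = cochain2 (\<lambda>x y. f x y - g x y :: 'v::ab_group_add)"
  by (rule cochain2_eqI) auto

lemma alt_maps_1_iff: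
  "f \<in> alt_maps sG sV 1 \<longleftrightarrow> (\<exists>\<chi>. f = cochain1 \<chi> \<and> Vector_Spaces.linear sG sV \<chi>)"
proof
  assume f: "f \<in> alt_maps sG sV 1"
  then have "f = cochain1 (\<lambda>x. f [x])"
    by (intro cochain1_eqI) (auto simp: alt_maps_def)
  \<comment> \<open>Linearity in \<open>alt_maps\<close> is phrased through updates of an existing
    list, so a dummy entry is supplied and then overwritten.\<close>
  moreover from f have "Vector_Spaces.linear sG sV (\<lambda>x. f ([undefined][0 := x]))"
    unfolding alt_maps_def mem_Collect_eq by (metis length_Cons list.size(3) One_nat_def lessI)
  ultimately show "\<exists>\<chi>. f = cochain1 \<chi> \<and> Vector_Spaces.linear sG sV \<chi>" by auto
qed (auto simp: alt_maps_def length_eq_1)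

lemma alt_maps_2_iff:
  "f \<in> alt_maps sG sV 2 \<longleftrightarrow>
    (\<exists>\<psi>. f = cochain2 \<psi> \<and> (\<forall>y. Vector_Spaces.linear sG sV (\<lambda>x. \<psi> x y)) \<and>
      (\<forall>x. Vector_Spaces.linear sG sV (\<psi> x)) \<and> (\<forall>x. \<psi> x x = 0))"
proof
  assume f: "f \<in> alt_maps sG sV 2"
  then have z: "length xs \<noteq> 2 \<Longrightarrow> f xs = 0"
    and l: "length xs = 2 \<Longrightarrow> i < 2 \<Longrightarrow> Vector_Spaces.linear sG sV (\<lambda>x. f (xs[i := x]))"
    and a: "length xs = 2 \<Longrightarrow> i < j \<Longrightarrow> j < 2 \<Longrightarrow> xs ! i = xs ! j \<Longrightarrow> f xs = 0" for xs i j
    unfolding alt_maps_def mem_Collect_eq by blast+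
  have "f = cochain2 (\<lambda>x y. f [x, y])"
    using z by (intro cochain2_eqI) auto
  then show "\<exists>\<psi>. f = cochain2 \<psi> \<and> (\<forall>y. Vector_Spaces.linear sG sV (\<lambda>x. \<psi> x y)) \<and>
      (\<forall>x. Vector_Spaces.linear sG sV (\<psi> x)) \<and> (\<forall>x. \<psi> x x = 0)"
    using l[of "[undefined, _]" 0] l[of "[_, undefined]" 1] a[of _ 0 1]
    by (intro exI[of _ "\<lambda>x y. f [x, y]"]) auto
qed (auto simp: alt_maps_def length_eq_2 less_2_cases_iff)

lemma scale_neg_one_and_one:
  "vector_space sV \<Longrightarrow> sV (- 1) v = - v" "vector_space sV \<Longrightarrow> sV 1 v = v"
  for sV :: "'k::field \<Rightarrow> 'v::ab_group_add \<Rightarrow> 'v"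
  by (metis module.scale_minus_left module.scale_one module_iff_vector_space)+

lemma d_Lie_1:
  assumes "vector_space sV"
  shows "d_Lie G sV \<rho> 1 (cochain1 \<chi>) =
    cochain2 (\<lambda>x y. \<rho> x (\<chi> y) - \<rho> y (\<chi> x) - \<chi> (brk G x y))"
  by (rule cochain2_eqI)
    (auto simp: d_Lie_def eval_nat_numeral omit_def scale_neg_one_and_one[OF assms])

text \<open>The sign convention multiplies the usual Chevalley-Eilenberg differential by (-1)^(n+1):
  the formula agrees with the usual one in degree one and is its negative here.\<close>

lemma d_Lie_2:
  assumes "vector_space sV"
  shows "d_Lie G sV \<rho> 2 (cochain2 \<psi>) xs = (case xs of
    [x, y, z] \<Rightarrow> - \<rho> x (\<psi> y z) + \<rho> y (\<psi> x z) - \<rho> z (\<psi> x y)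
      + \<psi> (brk G x y) z - \<psi> (brk G x z) y + \<psi> (brk G y z) x
    | _ \<Rightarrow> 0)"
proof (cases "length xs = 3")
  case True
  then obtain x y z where "xs = [x, y, z]" unfolding length_eq_3 by blast
  then show ?thesis
    by (auto simp: d_Lie_def eval_nat_numeral omit_def scale_neg_one_and_one[OF assms])
next
  case False
  then show ?thesis
    by (auto simp: d_Lie_def split: list.split)
qed

lemma delta_1:
  assumes "vector_space sV"
  shows "delta lam G sV dV 1 (cochain1 \<chi>) = cochain1 (\<lambda>x. \<chi> (der G x) - dV (\<chi> x))"
proof -
  have "{I. I \<subseteq> {..<1::nat} \<and> card I = 1} = {{0}}"
    by (auto simp: card_1_singleton_iff)
  then show ?thesis
    by (intro cochain1_eqI) (auto simp: delta_def scale_neg_one_and_one[OF assms])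
qed

lemma delta_2:
  assumes "vector_space sV"
  shows "delta lam G sV dV 2 (cochain2 \<psi>) =
    cochain2 (\<lambda>x y. \<psi> (der G x) y + \<psi> x (der G y) + sV lam (\<psi> (der G x) (der G y)) - dV (\<psi> x y))"
proof -
  \<comment> \<open>Singletons put the operator on one argument, with coefficient
    \<open>lam ^ 0\<close>; the full set puts it on both, with coefficient
    \<open>lam ^ 1\<close>.\<close>
  have "{I. I \<subseteq> {..<2::nat} \<and> card I = 1} = {{0}, {1}}"
    by (auto simp: card_1_singleton_iff less_2_cases_iff)
  moreover have "{I. I \<subseteq> {..<2::nat} \<and> card I = 2} = {{0, 1}}"
    by (auto simp: card_2_iff less_2_cases_iff)
  moreover have "{1..2::nat} = {1, 2}" by auto
  ultimately show ?thesis
    by (intro cochain2_eqI)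
      (auto simp: delta_def scale_neg_one_and_one[OF assms] upt_rec)
qed

section \<open>Cocycles and coboundaries in degree two\<close>

text \<open>The first equation is written with cyclic sums, unlike \<open>d_Lie_2\<close>, so that
  it can be matched term by term with the Jacobi identity.\<close>

definition cocycle_pair ::
  "'k::field \<Rightarrow> ('k, 'g::ab_group_add) diff_lie \<Rightarrow> ('k \<Rightarrow> 'v::ab_group_add \<Rightarrow> 'v) \<Rightarrow> ('v \<Rightarrow> 'v) \<Rightarrow>
    ('g \<Rightarrow> 'v \<Rightarrow> 'v) \<Rightarrow> ('g \<Rightarrow> 'g \<Rightarrow> 'v) \<Rightarrow> ('g \<Rightarrow> 'v) \<Rightarrow> bool" where
  "cocycle_pair lam G sV dV \<rho> \<psi> \<chi> \<longleftrightarrow>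
     (\<forall>y. Vector_Spaces.linear (scl G) sV (\<lambda>x. \<psi> x y)) \<and>
     (\<forall>x. Vector_Spaces.linear (scl G) sV (\<psi> x)) \<and> (\<forall>x. \<psi> x x = 0) \<and>
     Vector_Spaces.linear (scl G) sV \<chi> \<and>
     (\<forall>x y z. \<rho> x (\<psi> y z) + \<rho> y (\<psi> z x) + \<rho> z (\<psi> x y) =
        \<psi> (brk G x y) z + \<psi> (brk G y z) x + \<psi> (brk G z x) y) \<and>
     (\<forall>x y. \<chi> (brk G x y) + dV (\<psi> x y) =
        \<psi> (der G x) y + \<psi> x (der G y) + sV lam (\<psi> (der G x) (der G y)) +
        rho_weighted lam G \<rho> x (\<chi> y) - rho_weighted lam G \<rho> y (\<chi> x))"

text \<open>Polarization of the vanishing diagonal. It serves both the Lie bracket and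
  \<open>\<psi>\<close>.\<close>

lemma alternating_swap:
  assumes "\<And>x. \<psi> x x = 0" "\<And>y. Vector_Spaces.linear sG sV (\<lambda>x. \<psi> x y)"
    "\<And>x. Vector_Spaces.linear sG sV (\<psi> x)"
  shows "\<psi> y x = - \<psi> x y"
proof -
  have "\<psi> (x + y) (x + y) = (\<psi> x x + \<psi> y x) + (\<psi> x y + \<psi> y y)"
    by (simp only: linear_simps(1)[OF assms(2)] linear_simps(1)[OF assms(3)])
  then show ?thesis by (simp add: assms(1) eq_neg_iff_add_eq_0)
qed

lemma linear_vector_space:
  "Vector_Spaces.linear s1 s2 f \<Longrightarrow> vector_space s1"
  "Vector_Spaces.linear s1 s2 f \<Longrightarrow> vector_space s2"
  by (simp_all add: Vector_Spaces.linear_iff)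

lemma diff_lie_algebraD:
  assumes "diff_lie_algebra lam L"
  shows "vector_space (scl L)"
    "Vector_Spaces.linear (scl L) (scl L) (\<lambda>x. brk L x y)"
    "Vector_Spaces.linear (scl L) (scl L) (brk L x)"
    "brk L x x = 0"
    "brk L x (brk L y z) + brk L y (brk L z x) + brk L z (brk L x y) = 0"
    "Vector_Spaces.linear (scl L) (scl L) (der L)"
    "der L (brk L x y) = brk L (der L x) y + brk L x (der L y) + scl L lam (brk L (der L x) (der L y))"
    "brk L y x = - brk L x y"
proof -
  have L: "lie_algebra (scl L) (brk L)" using assms by (simp add: diff_lie_algebra_def)
  note ax = lie_algebra.linear_left[OF L] lie_algebra.linear_right[OF L]
    lie_algebra.bracket_self[OF L] lie_algebra.jacobi[OF L]
  show "brk L y x = - brk L x y"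
    by (rule alternating_swap[OF ax(3) ax(1) ax(2)])
  show "vector_space (scl L)"
    "Vector_Spaces.linear (scl L) (scl L) (\<lambda>x. brk L x y)"
    "Vector_Spaces.linear (scl L) (scl L) (brk L x)"
    "brk L x x = 0"
    "brk L x (brk L y z) + brk L y (brk L z x) + brk L z (brk L x y) = 0"
    by (fact lie_algebra.axioms(1)[OF L] ax)+
qed (use assms in \<open>auto simp: diff_lie_algebra_def\<close>)

lemma diff_lie_algebraI:
  assumes "\<And>y. Vector_Spaces.linear (scl L) (scl L) (\<lambda>x. brk L x y)"
    "\<And>x. Vector_Spaces.linear (scl L) (scl L) (brk L x)"
    "\<And>x. brk L x x = 0"
    "\<And>x y z. brk L x (brk L y z) + brk L y (brk L z x) + brk L z (brk L x y) = 0"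
    "Vector_Spaces.linear (scl L) (scl L) (der L)"
    "\<And>x y. der L (brk L x y) = brk L (der L x) y + brk L x (der L y) + scl L lam (brk L (der L x) (der L y))"
  shows "diff_lie_algebra lam L"
  unfolding diff_lie_algebra_def lie_algebra_def lie_algebra_axioms_def
  using assms linear_vector_space(1)[OF assms(5)] by blast

lemma rho_weighted_eq:
  assumes "diff_representation lam G sV dV \<rho>"
  shows "rho_weighted lam G \<rho> x v = \<rho> x v + sV lam (\<rho> (der G x) v)"
proof -
  have "Vector_Spaces.linear (scl G) sV (\<lambda>x. \<rho> x v)"
    using assms by (simp add: diff_representation_def)
  then show ?thesis by (simp add: rho_weighted_def Vector_Spaces.linear_iff)
qed

lemma DL_cocycles_2_iff:
  assumes G: "diff_lie_algebra lam G" and V: "vector_space sV"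
    and \<rho>: "diff_representation lam G sV dV \<rho>"
  shows "c \<in> DL_cocycles lam G sV dV \<rho> 2 \<longleftrightarrow>
    (\<exists>\<psi> \<chi>. c = (cochain2 \<psi>, cochain1 \<chi>) \<and> cocycle_pair lam G sV dV \<rho> \<psi> \<chi>)"
proof -
  have main: "d_DL lam G sV dV \<rho> 2 (cochain2 \<psi>, cochain1 \<chi>) = 0 \<longleftrightarrow>
     (\<forall>x y z. \<rho> x (\<psi> y z) + \<rho> y (\<psi> z x) + \<rho> z (\<psi> x y) =
        \<psi> (brk G x y) z + \<psi> (brk G y z) x + \<psi> (brk G z x) y) \<and>
     (\<forall>x y. \<chi> (brk G x y) + dV (\<psi> x y) =
        \<psi> (der G x) y + \<psi> x (der G y) + sV lam (\<psi> (der G x) (der G y)) +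
        rho_weighted lam G \<rho> x (\<chi> y) - rho_weighted lam G \<rho> y (\<chi> x))"
    (is "_ \<longleftrightarrow> ?L \<and> ?D")
    if l: "\<And>y. Vector_Spaces.linear (scl G) sV (\<lambda>x. \<psi> x y)"
      "\<And>x. Vector_Spaces.linear (scl G) sV (\<psi> x)" and a: "\<And>x. \<psi> x x = 0" for \<psi> \<chi>
  proof -
    have swap: "\<psi> y x = - \<psi> x y" for x y
      by (rule alternating_swap[OF a l])
    have \<rho>_neg: "\<rho> x (- v) = - \<rho> x v" for x v
      using \<rho> by (intro linear_simps(4)[of sV sV]) (auto simp: diff_representation_def)
    \<comment> \<open>The left side is the value of the differential on \<open>[x, y, z]\<close>.
      Exchanging z and x, in \<open>\<psi>\<close> and in the bracket, restores the cyclic order;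
      what results is \<open>?b - ?a\<close>.\<close>
    have Lxyz: "- \<rho> x (\<psi> y z) + \<rho> y (\<psi> x z) - \<rho> z (\<psi> x y)
      + \<psi> (brk G x y) z - \<psi> (brk G x z) y + \<psi> (brk G y z) x = 0 \<longleftrightarrow>
      \<rho> x (\<psi> y z) + \<rho> y (\<psi> z x) + \<rho> z (\<psi> x y) =
        \<psi> (brk G x y) z + \<psi> (brk G y z) x + \<psi> (brk G z x) y" (is "?l = 0 \<longleftrightarrow> ?a = ?b") for x y z
    proof -
      have "?l = ?b - ?a"
        using swap[of z x] diff_lie_algebraD(8)[OF G, of z x] linear_simps(4)[OF l(1), of "brk G x z" y]
        by (simp add: \<rho>_neg)
      then show ?thesis by (metis right_minus_eq)
    qed
    have 1: "d_Lie G sV \<rho> 2 (cochain2 \<psi>) = 0 \<longleftrightarrow> ?L"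
    proof
      assume *: "d_Lie G sV \<rho> 2 (cochain2 \<psi>) = 0"
      show ?L unfolding Lxyz[symmetric] using fun_cong[OF *, of "[_, _, _]"]
        by (simp add: d_Lie_2[OF V])
    next
      assume ?L then show "d_Lie G sV \<rho> 2 (cochain2 \<psi>) = 0"
        unfolding Lxyz[symmetric] by (auto simp: fun_eq_iff d_Lie_2[OF V] split: list.split)
    qed
    define F where "F x y = - (rho_weighted lam G \<rho> x (\<chi> y) - rho_weighted lam G \<rho> y (\<chi> x) - \<chi> (brk G x y))
      - (\<psi> (der G x) y + \<psi> x (der G y) + sV lam (\<psi> (der G x) (der G y)) - dV (\<psi> x y))" for x y
    have "(\<lambda>xs. - d_DO lam G sV \<rho> 1 (cochain1 \<chi>) xs - delta lam G sV dV 2 (cochain2 \<psi>) xs) =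
      cochain2 F"
      unfolding d_DO_def d_Lie_1[OF V] delta_2[OF V] F_def by (rule cochain2_eqI) auto
    moreover have "cochain2 F = 0 \<longleftrightarrow> (\<forall>x y. F x y = 0)"
    proof
      assume *: "cochain2 F = 0"
      show "\<forall>x y. F x y = 0" using fun_cong[OF *, of "[_, _]"] by simp
    qed (rule cochain2_eqI, auto)
    moreover have "F x y = (\<chi> (brk G x y) + dV (\<psi> x y)) -
        (\<psi> (der G x) y + \<psi> x (der G y) + sV lam (\<psi> (der G x) (der G y)) +
        rho_weighted lam G \<rho> x (\<chi> y) - rho_weighted lam G \<rho> y (\<chi> x))" for x y
      by (simp add: F_def)
    ultimately have 2: "(\<lambda>xs. - d_DO lam G sV \<rho> 1 (cochain1 \<chi>) xs - delta lam G sV dV 2 (cochain2 \<psi>) xs) = 0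
      \<longleftrightarrow> ?D" by (simp only: right_minus_eq)
    show ?thesis
      using 1 2 by (simp add: d_DL_def zero_prod_def)
  qed
  show ?thesis
  proof
    assume "c \<in> DL_cocycles lam G sV dV \<rho> 2"
    then have 1: "c \<in> alt_maps (scl G) sV 2 \<times> alt_maps (scl G) sV 1" and 2: "d_DL lam G sV dV \<rho> 2 c = 0"
      by (auto simp: DL_cocycles_def DL_cochains_def)
    from 1 2 main show "\<exists>\<psi> \<chi>. c = (cochain2 \<psi>, cochain1 \<chi>) \<and> cocycle_pair lam G sV dV \<rho> \<psi> \<chi>"
      unfolding cocycle_pair_def mem_Times_iff alt_maps_1_iff alt_maps_2_iff
      by (metis prod.collapse)
  next
    assume "\<exists>\<psi> \<chi>. c = (cochain2 \<psi>, cochain1 \<chi>) \<and> cocycle_pair lam G sV dV \<rho> \<psi> \<chi>"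
    then obtain \<psi> \<chi> where c: "c = (cochain2 \<psi>, cochain1 \<chi>)" and p: "cocycle_pair lam G sV dV \<rho> \<psi> \<chi>"
      by blast
    have "d_DL lam G sV dV \<rho> 2 c = 0"
      using p unfolding c cocycle_pair_def by (subst main) auto
    moreover have "c \<in> alt_maps (scl G) sV 2 \<times> alt_maps (scl G) sV 1"
      using p unfolding c cocycle_pair_def mem_Times_iff alt_maps_1_iff alt_maps_2_iff by auto
    ultimately show "c \<in> DL_cocycles lam G sV dV \<rho> 2"
      by (simp add: DL_cocycles_def DL_cochains_def)
  qed
qed

text \<open>This is \<open>d_DL\<close> of a 1-cochain. The minus sign in front of
  \<open>delta\<close> there explains why the second entry has \<open>dV (f x)\<close>
  first.\<close>

definition coboundary_pair ::
  "('k, 'g::ab_group_add) diff_lie \<Rightarrow> ('v::ab_group_add \<Rightarrow> 'v) \<Rightarrow> ('g \<Rightarrow> 'v \<Rightarrow> 'v) \<Rightarrow> ('g \<Rightarrow> 'v) \<Rightarrow>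
    ('g list \<Rightarrow> 'v) \<times> ('g list \<Rightarrow> 'v)" where
  "coboundary_pair G dV \<rho> f =
    (cochain2 (\<lambda>x y. \<rho> x (f y) - \<rho> y (f x) - f (brk G x y)), cochain1 (\<lambda>x. dV (f x) - f (der G x)))"

lemma DL_coboundaries_2:
  assumes G: "diff_lie_algebra lam G" and V: "vector_space sV"
    and \<rho>: "diff_representation lam G sV dV \<rho>"
  shows "DL_coboundaries lam G sV dV \<rho> 2 =
    coboundary_pair G dV \<rho> ` {f. Vector_Spaces.linear (scl G) sV f}"
proof -
  \<comment> \<open>The missing second entry of a 1-cochain is encoded as the function 0. Up to
    sign, \<open>d_DO\<close> in degree 0 sends it to values
    \<open>rho_weighted lam G \<rho> x 0\<close>, which must be seen to vanish.\<close>
  have \<rho>0: "rho_weighted lam G \<rho> x 0 = 0" for x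
    unfolding rho_weighted_def
    using \<rho> by (intro linear_simps(3)[of sV sV]) (auto simp: diff_representation_def)
  have "d_DO lam G sV \<rho> 0 0 xs = 0" for xs
    using V by (simp add: d_DO_def d_Lie_def \<rho>0 scale_neg_one_and_one)
  then have "d_DL lam G sV dV \<rho> 1 (cochain1 f, 0) = coboundary_pair G dV \<rho> f" for f
    unfolding d_DL_def coboundary_pair_def fst_conv snd_conv d_Lie_1[OF V] delta_1[OF V]
    by (auto intro!: cochain1_eqI)
  moreover have "DL_cochains G sV 1 = (\<lambda>f. (cochain1 f, 0)) ` {f. Vector_Spaces.linear (scl G) sV f}"
    by (auto simp: DL_cochains_def alt_maps_1_iff[unfolded One_nat_def])
  ultimately show ?thesis
    by (simp add: DL_coboundaries_def image_image)
qed

section \<open>Twisted products\<close>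

text \<open>Read \<open>(v, x)\<close> as i(v) + s(x). Expanding the bracket and the operator of an
  extension on such sums, with [i(v), i(w)] = 0, yields these formulas.\<close>

definition twisted ::
  "('k, 'g::ab_group_add) diff_lie \<Rightarrow> ('k \<Rightarrow> 'v::ab_group_add \<Rightarrow> 'v) \<Rightarrow> ('v \<Rightarrow> 'v) \<Rightarrow>
    ('g \<Rightarrow> 'v \<Rightarrow> 'v) \<Rightarrow> ('g \<Rightarrow> 'g \<Rightarrow> 'v) \<Rightarrow> ('g \<Rightarrow> 'v) \<Rightarrow> ('k, 'v, 'g, 'v \<times> 'g) extension" where
  "twisted G sV dV \<rho> \<psi> \<chi> =
    \<lparr>mid = \<lparr>scl = \<lambda>r (v, x). (sV r v, scl G r x),
            brk = \<lambda>(v, x) (w, y). (\<rho> x w - \<rho> y v + \<psi> x y, brk G x y),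
            der = \<lambda>(v, x). (dV v + \<chi> x, der G x)\<rparr>,
     inc = \<lambda>v. (v, 0), prj = snd\<rparr>"

lemma vector_space_twisted:
  "vector_space s1 \<Longrightarrow> vector_space s2 \<Longrightarrow> vector_space (\<lambda>r (v, x). (s1 r v, s2 r x))"
  by (auto simp: vector_space_def)

locale twisting =
  fixes lam :: "'k::field"
    and G :: "('k, 'g::ab_group_add) diff_lie"
    and sV :: "'k \<Rightarrow> 'v::ab_group_add \<Rightarrow> 'v"
    and dV :: "'v \<Rightarrow> 'v" and \<rho> \<psi> \<chi>
  assumes G: "diff_lie_algebra lam G"
    and V: "vector_space sV"
    and rep: "diff_representation lam G sV dV \<rho>"
    and cocycle: "cocycle_pair lam G sV dV \<rho> \<psi> \<chi>"
begin

abbreviation "T \<equiv> twisted G sV dV \<rho> \<psi> \<chi>"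

lemma rep_simps:
  "Vector_Spaces.linear sV sV (\<rho> x)" "Vector_Spaces.linear (scl G) sV (\<lambda>x. \<rho> x v)"
  "\<rho> (brk G x y) v = \<rho> x (\<rho> y v) - \<rho> y (\<rho> x v)"
  "Vector_Spaces.linear sV sV dV"
  "dV (\<rho> x v) = \<rho> (der G x) v + \<rho> x (dV v) + sV lam (\<rho> (der G x) (dV v))"
  using rep by (auto simp: diff_representation_def)

lemma cocycle_simps:
  "Vector_Spaces.linear (scl G) sV (\<lambda>x. \<psi> x y)" "Vector_Spaces.linear (scl G) sV (\<psi> x)"
  "\<psi> x x = 0" "Vector_Spaces.linear (scl G) sV \<chi>"
  "\<rho> x (\<psi> y z) + \<rho> y (\<psi> z x) + \<rho> z (\<psi> x y) =
     \<psi> (brk G x y) z + \<psi> (brk G y z) x + \<psi> (brk G z x) y"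
  "\<chi> (brk G x y) + dV (\<psi> x y) =
     \<psi> (der G x) y + \<psi> x (der G y) + sV lam (\<psi> (der G x) (der G y)) +
     rho_weighted lam G \<rho> x (\<chi> y) - rho_weighted lam G \<rho> y (\<chi> x)"
  using cocycle unfolding cocycle_pair_def by blast+

lemmas swap = alternating_swap[of \<psi>, OF cocycle_simps(3,1,2)]
lemmas G_simps = diff_lie_algebraD[OF G]
lemmas lin_simps = linear_simps[OF rep_simps(1)] linear_simps[OF rep_simps(2)]
  linear_simps[OF rep_simps(4)] linear_simps[OF cocycle_simps(1)]
  linear_simps[OF cocycle_simps(2)] linear_simps[OF cocycle_simps(4)]
  linear_simps[OF G_simps(2)] linear_simps[OF G_simps(3)] linear_simps[OF G_simps(6)]
lemmas scale_simps =
  module.scale_right_distrib[OF module_iff_vector_space[THEN iffD2, OF V]]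
  module.scale_right_diff_distrib[OF module_iff_vector_space[THEN iffD2, OF V]]
  module.scale_minus_right[OF module_iff_vector_space[THEN iffD2, OF V]]
  module.scale_zero_right[OF module_iff_vector_space[THEN iffD2, OF V]]
  module.scale_zero_right[OF module_iff_vector_space[THEN iffD2, OF G_simps(1)]]

lemma twisted_simps:
  "scl (mid T) r (v, x) = (sV r v, scl G r x)"
  "brk (mid T) (v, x) (w, y) = (\<rho> x w - \<rho> y v + \<psi> x y, brk G x y)"
  "der (mid T) (v, x) = (dV v + \<chi> x, der G x)"
  "inc T = (\<lambda>v. (v, 0))" "prj T = snd"
  by (simp_all add: twisted_def)

lemma twisted_vector_space: "vector_space (scl (mid T))"
  using vector_space_twisted[OF V G_simps(1)] by (simp add: twisted_def)

text \<open>The second coordinates satisfy the axioms because g does. In the first coordinate the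
  terms containing vectors of V cancel because \<open>\<rho>\<close> is a representation compatible
  with \<open>dV\<close>, and what remains is one of the two cocycle equations.\<close>

lemma twisted_diff_lie: "diff_lie_algebra lam (mid T)"
proof (rule diff_lie_algebraI)
  show "brk (mid T) a (brk (mid T) b c) + brk (mid T) b (brk (mid T) c a) +
      brk (mid T) c (brk (mid T) a b) = 0" for a b c
  proof -
    obtain u x v y w z where abc: "a = (u, x)" "b = (v, y)" "c = (w, z)" by fastforce
    \<comment> \<open>Jacobi produces brackets in the second argument of \<open>\<psi>\<close>, the
      cocycle equation has them in the first.\<close>
    have "\<psi> x (brk G y z) + \<psi> y (brk G z x) + \<psi> z (brk G x y) =
       - (\<rho> x (\<psi> y z) + \<rho> y (\<psi> z x) + \<rho> z (\<psi> x y))"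
      using swap[of x "brk G y z"] swap[of y "brk G z x"] swap[of z "brk G x y"]
      unfolding cocycle_simps(5) by simp
    then show ?thesis
      using G_simps(5)[of x y z]
      by (simp add: abc twisted_simps zero_prod_def lin_simps rep_simps(3) algebra_simps)
  qed
  show "der (mid T) (brk (mid T) a b) = brk (mid T) (der (mid T) a) b + brk (mid T) a (der (mid T) b)
      + scl (mid T) lam (brk (mid T) (der (mid T) a) (der (mid T) b))" for a b
  proof -
    obtain u x v y where ab: "a = (u, x)" "b = (v, y)" by fastforce
    \<comment> \<open>The cocycle equation is solved for \<open>dV (\<psi> x y)\<close> so that it
      can serve as a rewrite rule.\<close>
    have "dV (\<psi> x y) = \<psi> (der G x) y + \<psi> x (der G y) + sV lam (\<psi> (der G x) (der G y)) +
      rho_weighted lam G \<rho> x (\<chi> y) - rho_weighted lam G \<rho> y (\<chi> x) - \<chi> (brk G x y)"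
      unfolding cocycle_simps(6)[symmetric] by simp
    then show ?thesis
      by (simp add: ab twisted_simps G_simps(7) lin_simps rep_simps(5) scale_simps
          rho_weighted_eq[OF rep] algebra_simps)
  qed
qed (use twisted_vector_space in \<open>auto simp: Vector_Spaces.linear_iff twisted_simps lin_simps
      scale_simps G_simps(4) cocycle_simps(3) zero_prod_def algebra_simps\<close>)

lemma twisted_extension: "abelian_extension lam G sV dV T"
  unfolding abelian_extension_def diff_lie_hom_def Vector_Spaces.linear_iff
  using twisted_diff_lie twisted_vector_space V G_simps(1)
  by (auto simp: trivial_diff_lie_def twisted_simps lin_simps scale_simps zero_prod_def cocycle_simps(3)
      intro: injI)

lemma twisted_section: "is_section G T (Pair 0)"
  unfolding is_section_def Vector_Spaces.linear_iff
  using twisted_vector_space G_simps(1) by (auto simp: twisted_simps scale_simps)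

lemma inv_inc_twisted: "inv (inc T) (v, 0) = v"
  by (rule inv_f_eq) (auto simp: twisted_simps intro: injI)

lemma twisted_action: "induced_action T (Pair 0) = \<rho>"
  by (simp add: fun_eq_iff induced_action_def twisted_simps(1-3) inv_inc_twisted lin_simps)
     (simp add: twisted_simps lin_simps inv_inc_twisted[unfolded twisted_simps])

text \<open>The canonical section returns the given data exactly, not only up to a coboundary; this
  is what makes every cohomology class occur.\<close>

lemma twisted_cocycle: "ext_cocycle G T (Pair 0) = (cochain2 \<psi>, cochain1 \<chi>)"
  by (auto simp: ext_cocycle_def cochain2_def cochain1_def fun_eq_iff twisted_simps(1-3)
      inv_inc_twisted lin_simps split: list.split)

end

section \<open>Extensions with a section\<close>

locale split_extension =
  fixes lam :: "'k::field"
    and G :: "('k, 'g::ab_group_add) diff_lie"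
    and sV :: "'k \<Rightarrow> 'v::ab_group_add \<Rightarrow> 'v"
    and dV :: "'v \<Rightarrow> 'v"
    and E :: "('k, 'v, 'g, 'e::ab_group_add) extension"
    and s :: "'g \<Rightarrow> 'e"
  assumes G: "diff_lie_algebra lam G"
    and V: "vector_space sV"
    and dV: "Vector_Spaces.linear sV sV dV"
    and E: "abelian_extension lam G sV dV E"
    and s: "is_section G E s"
begin

abbreviation "i \<equiv> inc E"
abbreviation "p \<equiv> prj E"
abbreviation "\<rho> \<equiv> induced_action E s"
definition "\<psi> x y = inv i (brk (mid E) (s x) (s y) - s (brk G x y))"
definition "\<chi> x = inv i (der (mid E) (s x) - s (der G x))"

lemma mid: "diff_lie_algebra lam (mid E)"
  and i_hom: "diff_lie_hom (trivial_diff_lie sV dV) (mid E) i"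
  and p_hom: "diff_lie_hom (mid E) G p"
  and i_inj: "inj i"
  and exact: "range i = {e. p e = 0}"
  using E by (auto simp: abelian_extension_def)

text \<open>Since i preserves brackets and V has zero bracket, [i(v), i(w)] = i(0) = 0. The
  cancellations below rest on \<open>i_brk\<close>.\<close>

lemma i_linear: "Vector_Spaces.linear sV (scl (mid E)) i"
  and i_brk: "brk (mid E) (i v) (i w) = 0"
  and i_der: "der (mid E) (i v) = i (dV v)"
  using i_hom i_inj by (simp_all add: diff_lie_hom_def trivial_diff_lie_def)
    (metis Vector_Spaces.linear_iff linear_simps(3))

lemma p_linear: "Vector_Spaces.linear (scl (mid E)) (scl G) p"
  and p_brk: "p (brk (mid E) a b) = brk G (p a) (p b)"
  and p_der: "p (der (mid E) a) = der G (p a)"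
  using p_hom by (simp_all add: diff_lie_hom_def)

lemma s_linear: "Vector_Spaces.linear (scl G) (scl (mid E)) s" and p_s [simp]: "p (s x) = x"
  using s by (auto simp: is_section_def fun_eq_iff)

lemma p_i [simp]: "p (i v) = 0"
  using exact by auto

lemma i_inv: "p e = 0 \<Longrightarrow> i (inv i e) = e"
  using exact by (intro f_inv_into_f) auto

lemma inv_i [simp]: "inv i (i v) = v"
  using i_inj by simp

lemma i_eq_iff [simp]: "i v = i w \<longleftrightarrow> v = w"
  using i_inj by (auto dest: injD)

lemmas G_simps = diff_lie_algebraD[OF G]
lemmas E_simps = diff_lie_algebraD[OF mid]
lemmas i_simps = linear_simps[OF i_linear]
lemmas p_simps = linear_simps[OF p_linear]
lemmas s_simps = linear_simps[OF s_linear]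
lemmas brk_simps = linear_simps[OF E_simps(2)] linear_simps[OF E_simps(3)]
lemmas der_simps = linear_simps[OF E_simps(6)]
lemmas G_brk_simps = linear_simps[OF G_simps(2)] linear_simps[OF G_simps(3)]
lemmas G_der_simps = linear_simps[OF G_simps(6)]
lemmas scale_simps =
  module.scale_right_distrib[OF module_iff_vector_space[THEN iffD2, OF E_simps(1)]]
  module.scale_right_diff_distrib[OF module_iff_vector_space[THEN iffD2, OF E_simps(1)]]
  module.scale_minus_right[OF module_iff_vector_space[THEN iffD2, OF E_simps(1)]]
  module.scale_zero_right[OF module_iff_vector_space[THEN iffD2, OF E_simps(1)]]

text \<open>Each expression under \<open>inv i\<close> is killed by p, hence lies in i(V) by
  exactness. With \<open>i_rho\<close>, \<open>i_psi\<close> and \<open>i_chi\<close> an identity in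
  V can be proved by applying the injective map i and calculating in the middle term.\<close>

lemma i_rho: "i (\<rho> x v) = brk (mid E) (s x) (i v)"
  unfolding induced_action_def
  by (rule i_inv) (simp add: p_brk linear_simps(3)[OF G_simps(3)])

lemma i_psi: "i (\<psi> x y) = brk (mid E) (s x) (s y) - s (brk G x y)"
  unfolding \<psi>_def
  by (rule i_inv) (simp add: p_brk p_simps)

lemma i_chi: "i (\<chi> x) = der (mid E) (s x) - s (der G x)"
  unfolding \<chi>_def
  by (rule i_inv) (simp add: p_der p_simps)

lemma brk_i_s: "brk (mid E) (i v) (s x) = - i (\<rho> x v)"
  by (metis E_simps(8) i_rho)

lemma brk_s_s: "brk (mid E) (s x) (s y) = i (\<psi> x y) + s (brk G x y)"
  by (simp add: i_psi)

lemma der_s: "der (mid E) (s x) = i (\<chi> x) + s (der G x)"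
  by (simp add: i_chi)

text \<open>Compatibility with brackets is Jacobi for s(x), s(y), i(v): the difference between
  [s(x), s(y)] and s([x,y]) lies in i(V) and so annihilates i(v). Compatibility with the operators
  is the Leibniz rule for s(x) and i(v), where the term from \<open>\<chi>\<close> disappears for
  the same reason.\<close>

lemma representation: "diff_representation lam G sV dV \<rho>"
proof -
  have 1: "Vector_Spaces.linear sV sV (\<rho> x)" for x
    unfolding Vector_Spaces.linear_iff
    by (intro conjI V allI i_eq_iff[THEN iffD1])
      (simp_all only: i_simps i_rho brk_simps)
  have 2: "Vector_Spaces.linear (scl G) sV (\<lambda>x. \<rho> x v)" for v
    unfolding Vector_Spaces.linear_iff
    by (intro conjI V G_simps(1) allI i_eq_iff[THEN iffD1])
      (simp_all only: i_simps i_rho s_simps brk_simps)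
  have 3: "\<rho> (brk G x y) v = \<rho> x (\<rho> y v) - \<rho> y (\<rho> x v)" for x y v
  proof (rule i_eq_iff[THEN iffD1])
    have "i (\<rho> (brk G x y) v) = brk (mid E) (brk (mid E) (s x) (s y)) (i v)"
      by (simp add: brk_s_s brk_simps i_brk i_rho)
    also have "\<dots> = - brk (mid E) (i v) (brk (mid E) (s x) (s y))"
      by (rule E_simps(8))
    also have "\<dots> = brk (mid E) (s x) (brk (mid E) (s y) (i v)) + brk (mid E) (s y) (brk (mid E) (i v) (s x))"
      using E_simps(5)[of "s x" "s y" "i v"] by (simp only: eq_neg_iff_add_eq_0[symmetric])
    also have "\<dots> = i (\<rho> x (\<rho> y v) - \<rho> y (\<rho> x v))"
      by (simp add: brk_i_s i_simps brk_simps i_rho)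
    finally show "i (\<rho> (brk G x y) v) = i (\<rho> x (\<rho> y v) - \<rho> y (\<rho> x v))" .
  qed
  have 4: "dV (\<rho> x v) = \<rho> (der G x) v + \<rho> x (dV v) + sV lam (\<rho> (der G x) (dV v))" for x v
  proof (rule i_eq_iff[THEN iffD1])
    have "i (dV (\<rho> x v)) = der (mid E) (brk (mid E) (s x) (i v))"
      by (simp add: i_der[symmetric] i_rho)
    also have "\<dots> = i (\<rho> (der G x) v + \<rho> x (dV v) + sV lam (\<rho> (der G x) (dV v)))"
      by (simp add: E_simps(7) der_s i_der brk_simps i_brk i_rho i_simps)
    finally show "i (dV (\<rho> x v)) = \<dots>" .
  qed
  show ?thesis
    unfolding diff_representation_def using 1 2 3 4 dV by blast
qed

lemma cocycle: "cocycle_pair lam G sV dV \<rho> \<psi> \<chi>"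
proof -
  have 1: "Vector_Spaces.linear (scl G) sV (\<lambda>x. \<psi> x y)" for y
    unfolding Vector_Spaces.linear_iff
    by (intro conjI V G_simps(1) allI i_eq_iff[THEN iffD1])
      (simp_all add: i_simps i_psi s_simps brk_simps G_brk_simps scale_simps del: i_eq_iff)
  have 2: "Vector_Spaces.linear (scl G) sV (\<psi> x)" for x
    unfolding Vector_Spaces.linear_iff
    by (intro conjI V G_simps(1) allI i_eq_iff[THEN iffD1])
      (simp_all add: i_simps i_psi s_simps brk_simps G_brk_simps scale_simps del: i_eq_iff)
  have 3: "\<psi> x x = 0" for x
    by (rule i_eq_iff[THEN iffD1]) (simp add: i_psi i_simps E_simps(4) G_simps(4) s_simps del: i_eq_iff)
  have 4: "Vector_Spaces.linear (scl G) sV \<chi>"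
    unfolding Vector_Spaces.linear_iff
    by (intro conjI V G_simps(1) allI i_eq_iff[THEN iffD1])
      (simp_all add: i_simps i_chi s_simps der_simps G_der_simps scale_simps del: i_eq_iff)
  have 5: "\<rho> x (\<psi> y z) + \<rho> y (\<psi> z x) + \<rho> z (\<psi> x y) =
        \<psi> (brk G x y) z + \<psi> (brk G y z) x + \<psi> (brk G z x) y" for x y z
  proof (rule i_eq_iff[THEN iffD1])
    \<comment> \<open>In the cyclic sum of this identity the double brackets cancel by Jacobi in the
      middle term and the last summands by Jacobi in g, leaving only \<open>\<psi>\<close>.\<close>
    have r: "i (\<rho> x (\<psi> y z)) =
       brk (mid E) (s x) (brk (mid E) (s y) (s z)) + i (\<psi> (brk G y z) x) - s (brk G x (brk G y z))" for x y z
      using E_simps(8)[of "s x" "s (brk G y z)"] G_simps(8)[of x "brk G y z"]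
      by (simp add: i_rho i_psi brk_simps s_simps)
    have "s (brk G x (brk G y z)) + s (brk G y (brk G z x)) + s (brk G z (brk G x y)) = 0"
      using G_simps(5)[of x y z] by (metis s_simps(1,3))
    with E_simps(5)[of "s x" "s y" "s z"]
    show "i (\<rho> x (\<psi> y z) + \<rho> y (\<psi> z x) + \<rho> z (\<psi> x y)) =
        i (\<psi> (brk G x y) z + \<psi> (brk G y z) x + \<psi> (brk G z x) y)"
      unfolding i_simps r
      by (simp add: algebra_simps)
  qed
  have 6: "\<chi> (brk G x y) + dV (\<psi> x y) =
        \<psi> (der G x) y + \<psi> x (der G y) + sV lam (\<psi> (der G x) (der G y)) +
        rho_weighted lam G \<rho> x (\<chi> y) - rho_weighted lam G \<rho> y (\<chi> x)" for x y
  proof (rule i_eq_iff[THEN iffD1])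
    \<comment> \<open>The two occurrences of d(s([x,y])), one from \<open>\<chi>\<close> and one
      from \<open>dV\<close>, cancel.\<close>
    have l: "i (\<chi> (brk G x y) + dV (\<psi> x y)) = der (mid E) (brk (mid E) (s x) (s y)) - s (der G (brk G x y))"
      by (simp add: i_simps i_chi i_psi i_der[symmetric] der_simps)
    show "i (\<chi> (brk G x y) + dV (\<psi> x y)) =
      i (\<psi> (der G x) y + \<psi> x (der G y) + sV lam (\<psi> (der G x) (der G y)) +
        rho_weighted lam G \<rho> x (\<chi> y) - rho_weighted lam G \<rho> y (\<chi> x))"
      \<comment> \<open>Here \<open>rho_weighted\<close> originates: the summand lambda
        [d(s(x)), d(s(y))] of the Leibniz rule adds lambda
        \<open>\<rho> (der G x) (\<chi> y)\<close> to the term \<open>\<rho> x (\<chi> y)\<close>,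
        and symmetrically in x and y. The bracket of the two \<open>\<chi>\<close> parts is
        zero.\<close>
      unfolding l rho_weighted_eq[OF representation] E_simps(7) G_simps(7)
      by (simp only: der_s brk_simps s_simps scale_simps i_simps i_brk brk_i_s i_rho[symmetric] brk_s_s)
        (simp add: algebra_simps)
  qed
  show ?thesis
    unfolding cocycle_pair_def using 1 2 3 4 5 6 by blast
qed

lemma ext_cocycle_eq: "ext_cocycle G E s = (cochain2 \<psi>, cochain1 \<chi>)"
  by (simp add: ext_cocycle_def \<psi>_def \<chi>_def cochain1_def cochain2_def fun_eq_iff split: list.split)

text \<open>Brackets of i(f(x)) with i(v) or i(f(y)) vanish. Hence the action does not notice the
  shift, and the change of the cocycle is linear in f.\<close>

lemma section_shift:
  assumes f: "Vector_Spaces.linear (scl G) sV f"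
  defines "t \<equiv> \<lambda>x. s x + i (f x)"
  shows "is_section G E t"
    and "induced_action E t = \<rho>"
    and "ext_cocycle G E t - ext_cocycle G E s = coboundary_pair G dV \<rho> f"
proof -
  note f_simps = linear_simps[OF f]
  show t: "is_section G E t"
    unfolding is_section_def Vector_Spaces.linear_iff
    by (auto simp: G_simps(1) E_simps(1) t_def s_simps i_simps f_simps p_simps scale_simps)
  show "induced_action E t = \<rho>"
    by (simp add: fun_eq_iff induced_action_def t_def brk_simps i_brk)
  interpret t: split_extension lam G sV dV E t
    by (intro split_extension.intro G V dV E t)
  have "t.\<psi> x y - \<psi> x y = \<rho> x (f y) - \<rho> y (f x) - f (brk G x y)" for x y
    by (rule i_eq_iff[THEN iffD1], unfold i_simps t.i_psi i_psi)
      (simp add: i_rho[symmetric] brk_i_s t_def brk_simps i_brk)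
  moreover have "t.\<chi> x - \<chi> x = dV (f x) - f (der G x)" for x
    by (rule i_eq_iff[THEN iffD1], unfold i_simps t.i_chi i_chi)
      (simp add: t_def der_simps i_der)
  ultimately show "ext_cocycle G E t - ext_cocycle G E s = coboundary_pair G dV \<rho> f"
    by (simp add: t.ext_cocycle_eq ext_cocycle_eq coboundary_pair_def cochain1_diff cochain2_diff)
qed

text \<open>The difference of two sections is killed by p, so it takes values in i(V).\<close>

lemma section_shift_exists:
  assumes "is_section G E t"
  obtains f where "Vector_Spaces.linear (scl G) sV f" "t = (\<lambda>x. s x + i (f x))"
proof -
  interpret t: split_extension lam G sV dV E t
    by (intro split_extension.intro G V dV E assms)
  define f where "f x = inv i (t x - s x)" for x
  have i_f: "i (f x) = t x - s x" for x
    unfolding f_def by (rule i_inv) (simp add: p_simps)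
  show thesis
  proof (rule that[of f])
    show "Vector_Spaces.linear (scl G) sV f"
      unfolding Vector_Spaces.linear_iff
      by (intro conjI V G_simps(1) allI i_eq_iff[THEN iffD1])
        (simp_all add: i_simps i_f s_simps t.s_simps scale_simps del: i_eq_iff)
  qed (simp add: i_f)
qed

lemma ext_iso_twisted: "ext_iso (twisted G sV dV \<rho> \<psi> \<chi>) E"
proof -
  let ?T = "twisted G sV dV \<rho> \<psi> \<chi>"
  define \<phi> where "\<phi> = (\<lambda>(v, x). i v + s x)"
  have "diff_lie_hom (mid ?T) (mid E) \<phi>"
    unfolding diff_lie_hom_def Vector_Spaces.linear_iff
    by (auto simp: twisted_def \<phi>_def i_simps s_simps scale_simps brk_simps i_brk brk_s_s
        brk_i_s i_rho[symmetric] der_simps i_der der_s E_simps(1) vector_space_twisted[OF V G_simps(1)])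
  moreover have "bij \<phi>"
  proof (rule bijI)
    show "inj \<phi>"
    proof (rule injI)
      fix a b assume eq: "\<phi> a = \<phi> b"
      then have "p (\<phi> a) = p (\<phi> b)" by (rule arg_cong)
      then have "snd a = snd b" by (cases a; cases b) (simp add: \<phi>_def p_simps)
      with eq show "a = b" by (cases a; cases b) (simp add: \<phi>_def)
    qed
    \<comment> \<open>Subtracting s(p(e)) from e leaves an element of the kernel of p, which is
      i(V).\<close>
    have "\<phi> (inv i (e - s (p e)), p e) = e" for e
      by (simp add: \<phi>_def i_inv p_simps)
    then show "surj \<phi>" unfolding surj_def by metis
  qed
  moreover have "\<phi> \<circ> inc ?T = inc E" "prj E \<circ> \<phi> = prj ?T"
    by (auto simp: \<phi>_def twisted_def fun_eq_iff p_simps s_simps)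
  ultimately show ?thesis
    unfolding ext_iso_def by blast
qed

lemma induced_action_section: "is_section G E t \<Longrightarrow> induced_action E t = \<rho>"
  by (erule section_shift_exists) (simp add: section_shift(2))

text \<open>Any two sections differ by a shift, and shifts preserve the action; so the relation
  \<open>induces\<close> is a function of the extension.\<close>

lemma induces_iff: "induces G E r \<longleftrightarrow> r = \<rho>"
  unfolding induces_def by (blast intro: s dest: induced_action_section)

lemma ext_cocycle_in_cocycles: "ext_cocycle G E s \<in> DL_cocycles lam G sV dV \<rho> 2"
  unfolding DL_cocycles_2_iff[OF G V representation] using ext_cocycle_eq cocycle by blast

text \<open>The map \<open>\<phi>\<close> carries i and s to the inclusion of F and the new section,
  and it respects brackets and operators. The expressions defining action and cocycle in F are
  therefore images of those in E, so the two cocycles are equal and not merely cohomologous.\<close>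

lemma transport_section:
  assumes F: "abelian_extension lam G sV dV F"
    and \<phi>: "diff_lie_hom (mid E) (mid F) \<phi>" "\<phi> \<circ> inc E = inc F" "prj F \<circ> \<phi> = prj E"
  shows "is_section G F (\<phi> \<circ> s)"
    and "induced_action F (\<phi> \<circ> s) = \<rho>"
    and "ext_cocycle G F (\<phi> \<circ> s) = ext_cocycle G E s"
proof -
  have lin: "Vector_Spaces.linear (scl (mid E)) (scl (mid F)) \<phi>"
    and brk: "brk (mid F) (\<phi> a) (\<phi> b) = \<phi> (brk (mid E) a b)"
    and der: "der (mid F) (\<phi> a) = \<phi> (der (mid E) a)"
    and inc: "inc F v = \<phi> (i v)"
    and prj: "prj F (\<phi> a) = p a" for a b v
    using \<phi>(1) fun_cong[OF \<phi>(2), of v] fun_cong[OF \<phi>(3), of a] by (auto simp: diff_lie_hom_def)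
  note \<phi>_simps = linear_simps[OF lin]
  show t: "is_section G F (\<phi> \<circ> s)"
    unfolding is_section_def
    using Vector_Spaces.linear_compose[OF s_linear lin] by (simp add: fun_eq_iff prj)
  interpret F: split_extension lam G sV dV F "\<phi> \<circ> s"
    by (intro split_extension.intro G V dV F t)
  have inv: "inv (inc F) (\<phi> (i v)) = v" for v
    by (metis F.inv_i inc)
  show "induced_action F (\<phi> \<circ> s) = \<rho>"
    by (simp add: fun_eq_iff induced_action_def[of F] inc brk i_rho[symmetric] inv)
  have "F.\<psi> x y = \<psi> x y" for x y
    by (simp add: F.\<psi>_def brk \<phi>_simps(5)[symmetric] i_psi[symmetric] inv)
  moreover have "F.\<chi> x = \<chi> x" for x
    by (simp add: F.\<chi>_def der \<phi>_simps(5)[symmetric] i_chi[symmetric] inv)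
  ultimately have "F.\<psi> = \<psi>" "F.\<chi> = \<chi>"
    by (auto simp: fun_eq_iff)
  then show "ext_cocycle G F (\<phi> \<circ> s) = ext_cocycle G E s"
    by (simp add: F.ext_cocycle_eq ext_cocycle_eq)
qed

end

text \<open>Over a field a surjective linear map has a linear right inverse. It need not respect
  brackets or operators; \<open>\<psi>\<close> and \<open>\<chi>\<close> measure this
  failure.\<close>

lemma section_exists:
  assumes "abelian_extension lam G sV dV E"
  obtains s where "is_section G E s"
proof -
  have p: "Vector_Spaces.linear (scl (mid E)) (scl G) (prj E)" and "surj (prj E)"
    using assms by (auto simp: abelian_extension_def diff_lie_hom_def)
  interpret vector_space_pair "scl (mid E)" "scl G"
    using p by (simp add: vector_space_pair_def linear_vector_space)
  show thesis
    using linear_surjective_right_inverse[OF p \<open>surj (prj E)\<close>] that by (auto simp: is_section_def)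
qed

section \<open>Classification\<close>

lemma ext_iso_refl:
  assumes "abelian_extension lam G sV dV E"
  shows "ext_iso E E"
  unfolding ext_iso_def
  by (rule exI[of _ id])
    (use assms in \<open>auto simp: abelian_extension_def diff_lie_hom_def Vector_Spaces.linear_iff\<close>)

lemma ext_iso_sym:
  assumes "ext_iso E F"
  shows "ext_iso F E"
proof -
  obtain \<phi> where \<phi>: "diff_lie_hom (mid E) (mid F) \<phi>" "bij \<phi>" "\<phi> \<circ> inc E = inc F" "prj F \<circ> \<phi> = prj E"
    using assms by (auto simp: ext_iso_def)
  have inv: "\<phi> (inv \<phi> y) = y" "inv \<phi> (\<phi> x) = x" for x y
    using \<phi>(2) by (simp_all add: bij_is_surj surj_f_inv_f bij_is_inj)
  have inj: "\<phi> x = \<phi> y \<Longrightarrow> x = y" for x y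
    using \<phi>(2) by (auto dest: bij_is_inj injD)
  have "diff_lie_hom (mid F) (mid E) (inv \<phi>)"
    using \<phi>(1) unfolding diff_lie_hom_def Vector_Spaces.linear_iff
    \<comment> \<open>Equations between preimages are checked after applying the injective
      \<open>\<phi>\<close>.\<close>
    by (intro conjI allI; (intro inj)?) (simp_all add: inv)
  moreover have "inv \<phi> \<circ> inc F = inc E" "prj E \<circ> inv \<phi> = prj F"
    unfolding \<phi>(3)[symmetric] \<phi>(4)[symmetric] by (auto simp: inv fun_eq_iff)
  ultimately show ?thesis
    using bij_imp_bij_inv[OF \<phi>(2)] by (auto simp: ext_iso_def)
qed

lemma ext_iso_trans:
  assumes "ext_iso E F" "ext_iso F H"
  shows "ext_iso E H"
proof -
  obtain \<phi> where \<phi>: "diff_lie_hom (mid E) (mid F) \<phi>" "bij \<phi>" "\<phi> \<circ> inc E = inc F" "prj F \<circ> \<phi> = prj E"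
    using assms by (auto simp: ext_iso_def)
  obtain \<theta> where \<theta>: "diff_lie_hom (mid F) (mid H) \<theta>" "bij \<theta>" "\<theta> \<circ> inc F = inc H" "prj H \<circ> \<theta> = prj F"
    using assms by (auto simp: ext_iso_def)
  have "diff_lie_hom (mid E) (mid H) (\<theta> \<circ> \<phi>)"
    using \<phi>(1) \<theta>(1) by (auto simp: diff_lie_hom_def intro: Vector_Spaces.linear_compose)
  moreover have "(\<theta> \<circ> \<phi>) \<circ> inc E = inc H" "prj H \<circ> (\<theta> \<circ> \<phi>) = prj E"
    using \<phi>(3,4) \<theta>(3,4) by (auto simp: fun_eq_iff)
  ultimately show ?thesis
    using bij_comp[OF \<phi>(2) \<theta>(2)] unfolding ext_iso_def by blast
qed

section \<open>The subgroup of coboundaries and the cohomology relation\<close>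

lemma coboundary_pair_diff:
  assumes \<rho>: "diff_representation lam G sV dV \<rho>"
  shows "coboundary_pair G dV \<rho> f - coboundary_pair G dV \<rho> g = coboundary_pair G dV \<rho> (\<lambda>x. f x - g x)"
proof -
  have diff: "\<rho> x (v - w) = \<rho> x v - \<rho> x w" "dV (v - w) = dV v - dV w" for x v w
    using \<rho> by (auto simp: diff_representation_def linear_simps(5)[of sV sV])
  show ?thesis
    unfolding coboundary_pair_def by (simp add: cochain1_diff cochain2_diff fun_eq_iff diff algebra_simps)
qed

lemma equiv_DL_cohomologous:
  assumes G: "diff_lie_algebra lam G" and V: "vector_space sV"
    and \<rho>: "diff_representation lam G sV dV \<rho>"
  shows "equiv (DL_cocycles lam G sV dV \<rho> 2) (DL_cohomologous lam G sV dV \<rho> 2)"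
proof -
  let ?B = "DL_coboundaries lam G sV dV \<rho> 2"
  interpret vector_space_pair "scl G" sV
    using V diff_lie_algebraD(1)[OF G] by (simp add: vector_space_pair_def)
  \<comment> \<open>Closure under differences, with one known element, yields zero, negatives and
    sums; these are reflexivity, symmetry and transitivity of the relation.\<close>
  have diff: "a - b \<in> ?B" if "a \<in> ?B" "b \<in> ?B" for a b
    using that linear_compose_sub
    unfolding DL_coboundaries_2[OF G V \<rho>] by (auto simp: coboundary_pair_diff[OF \<rho>])
  obtain c where "c \<in> ?B"
    using linear_zero unfolding DL_coboundaries_2[OF G V \<rho>] by blast
  then have zero: "0 \<in> ?B" using diff[of c c] by simp
  have neg: "b - a \<in> ?B" if "a - b \<in> ?B" for a b
    using diff[OF zero that] by simp
  have trans: "a - c \<in> ?B" if "a - b \<in> ?B" "b - c \<in> ?B" for a b c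
    using diff[OF that(1) neg[OF that(2)]] by simp
  show ?thesis
  proof (rule equivI)
    show "refl_on (DL_cocycles lam G sV dV \<rho> 2) (DL_cohomologous lam G sV dV \<rho> 2)"
      using zero by (simp add: refl_on_def DL_cohomologous_def)
    show "sym (DL_cohomologous lam G sV dV \<rho> 2)"
      unfolding sym_def DL_cohomologous_def using neg by blast
    show "trans (DL_cohomologous lam G sV dV \<rho> 2)"
      unfolding trans_def DL_cohomologous_def using trans by blast
    show "DL_cohomologous lam G sV dV \<rho> 2 \<subseteq> DL_cocycles lam G sV dV \<rho> 2 \<times> DL_cocycles lam G sV dV \<rho> 2"
      unfolding DL_cohomologous_def by blast
  qed
qed

lemma induced_representation:
  assumes G: "diff_lie_algebra lam G" and V: "vector_space sV" "Vector_Spaces.linear sV sV dV"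
    and E: "abelian_extension lam G sV dV E"
  shows "\<exists>!\<rho>. induces G E \<rho>"
    and "induces G E \<rho> \<Longrightarrow> diff_representation lam G sV dV \<rho>"
proof -
  obtain s where s: "is_section G E s" using section_exists[OF E] .
  interpret E: split_extension lam G sV dV E s
    by (intro split_extension.intro G V E s)
  show "\<exists>!\<rho>. induces G E \<rho>" unfolding E.induces_iff by simp
  show "induces G E \<rho> \<Longrightarrow> diff_representation lam G sV dV \<rho>"
    unfolding E.induces_iff using E.representation by simp
qed

lemma induces_ext_iso:
  assumes G: "diff_lie_algebra lam G" and V: "vector_space sV" "Vector_Spaces.linear sV sV dV"
    and E: "abelian_extension lam G sV dV E" and F: "abelian_extension lam G sV dV F"
    and iso: "ext_iso E F" and \<rho>: "induces G E \<rho>"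
  shows "induces G F \<rho>"
proof -
  obtain s where s: "is_section G E s" "induced_action E s = \<rho>"
    using \<rho> by (auto simp: induces_def)
  interpret E: split_extension lam G sV dV E s
    by (intro split_extension.intro G V E s)
  obtain \<phi> where "diff_lie_hom (mid E) (mid F) \<phi>" "\<phi> \<circ> inc E = inc F" "prj F \<circ> \<phi> = prj E"
    using iso by (auto simp: ext_iso_def)
  from E.transport_section[OF F this] s(2) show ?thesis
    by (auto simp: induces_def)
qed

section \<open>Extensions inducing a fixed representation\<close>

locale diff_lie_representation =
  fixes lam :: "'k::field"
    and G :: "('k, 'g::ab_group_add) diff_lie"
    and sV :: "'k \<Rightarrow> 'v::ab_group_add \<Rightarrow> 'v"
    and dV :: "'v \<Rightarrow> 'v" and \<rho>
  assumes G: "diff_lie_algebra lam G"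
    and V: "vector_space sV"
    and rep: "diff_representation lam G sV dV \<rho>"
begin

abbreviation "Ext \<equiv> extensions_inducing lam G sV dV \<rho>"
abbreviation "Z \<equiv> DL_cocycles lam G sV dV \<rho> 2"
abbreviation "coh \<equiv> DL_cohomologous lam G sV dV \<rho> 2"
abbreviation "cls \<equiv> ext_class lam G sV dV \<rho>"

lemmas coh_equiv = equiv_DL_cohomologous[OF G V rep]

lemma dV: "Vector_Spaces.linear sV sV dV"
  using rep by (simp add: diff_representation_def)

text \<open>Membership in \<open>Ext\<close> only says that some section induces
  \<open>\<rho>\<close>; independence of the section upgrades this to the given one.\<close>

lemma ExtD:
  assumes "E \<in> Ext" "is_section G E s"
  shows "split_extension lam G sV dV E s" "induced_action E s = \<rho>"
proof -
  show *: "split_extension lam G sV dV E s"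
    using assms G V dV by (simp add: extensions_inducing_def split_extension_def)
  show "induced_action E s = \<rho>"
    using assms split_extension.induces_iff[OF *] by (simp add: extensions_inducing_def)
qed

lemma Ext_section:
  assumes "E \<in> Ext"
  obtains s where "is_section G E s"
proof -
  have "abelian_extension lam G sV dV E" using assms by (simp add: extensions_inducing_def)
  then show thesis by (rule section_exists) (rule that)
qed

lemma ext_cocycle_cocycle:
  assumes "E \<in> Ext" "is_section G E s"
  shows "ext_cocycle G E s \<in> Z"
  using split_extension.ext_cocycle_in_cocycles[OF ExtD(1)[OF assms]] ExtD(2)[OF assms] by simp

text \<open>This removes the choice hidden in \<open>ext_class\<close>: the section picked by
  \<open>SOME\<close> is a shift of s, and a shift changes the cocycle by a coboundary.\<close>

lemma ext_cocycle_class: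
  assumes "E \<in> Ext" "is_section G E s"
  shows "coh `` {ext_cocycle G E s} = cls E"
proof -
  define t where "t = (SOME s. is_section G E s)"
  have t: "is_section G E t" unfolding t_def by (rule someI[of "is_section G E", OF assms(2)])
  interpret E: split_extension lam G sV dV E s by (rule ExtD(1)[OF assms])
  obtain f where f: "Vector_Spaces.linear (scl G) sV f" "t = (\<lambda>x. s x + inc E (f x))"
    using E.section_shift_exists[OF t] .
  have "ext_cocycle G E t - ext_cocycle G E s = coboundary_pair G dV \<rho> f"
    using E.section_shift(3)[OF f(1)] unfolding ExtD(2)[OF assms] f(2) .
  then have "(ext_cocycle G E t, ext_cocycle G E s) \<in> coh"
    using f(1) ext_cocycle_cocycle[OF assms] ext_cocycle_cocycle[OF assms(1) t]
    unfolding DL_cohomologous_def DL_coboundaries_2[OF G V rep] by simp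
  then show ?thesis
    unfolding ext_class_def t_def[symmetric] by (rule equiv_class_eq[OF coh_equiv, symmetric])
qed

lemma ext_iso_twisted_cocycle:
  assumes "E \<in> Ext" "is_section G E s" "ext_cocycle G E s = (cochain2 \<psi>, cochain1 \<chi>)"
  shows "ext_iso (twisted G sV dV \<rho> \<psi> \<chi>) E"
proof -
  interpret E: split_extension lam G sV dV E s by (rule ExtD(1)[OF assms(1,2)])
  show ?thesis
    using E.ext_iso_twisted assms(3) E.ext_cocycle_eq ExtD(2)[OF assms(1,2)] by simp
qed

lemma ext_iso_iff_class:
  assumes E: "E \<in> Ext" and F: "F \<in> Ext"
  shows "ext_iso E F \<longleftrightarrow> cls E = cls F"
proof
  obtain s where s: "is_section G E s" using Ext_section[OF E] .
  obtain t where t: "is_section G F t" using Ext_section[OF F] .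
  interpret E: split_extension lam G sV dV E s by (rule ExtD(1)[OF E s])
  interpret F: split_extension lam G sV dV F t by (rule ExtD(1)[OF F t])
  {
    assume "ext_iso E F"
    then obtain \<phi> where "diff_lie_hom (mid E) (mid F) \<phi>" "\<phi> \<circ> inc E = inc F" "prj F \<circ> \<phi> = prj E"
      by (auto simp: ext_iso_def)
    note \<phi> = E.transport_section[OF F.E this]
    show "cls E = cls F"
      unfolding ext_cocycle_class[OF E s, symmetric] ext_cocycle_class[OF F \<phi>(1), symmetric] \<phi>(3) ..
  next
    assume "cls E = cls F"
    then have "(ext_cocycle G E s, ext_cocycle G F t) \<in> coh"
      using ext_cocycle_class[OF E s] ext_cocycle_class[OF F t]
        eq_equiv_class_iff[OF coh_equiv ext_cocycle_cocycle[OF E s] ext_cocycle_cocycle[OF F t]]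
      by simp
    \<comment> \<open>The cochain f that witnesses cohomology is used to correct t: after the shift
      by f, F has the same cocycle as E.\<close>
    then obtain f where f: "Vector_Spaces.linear (scl G) sV f"
      and "ext_cocycle G E s - ext_cocycle G F t = coboundary_pair G dV \<rho> f"
      unfolding DL_cohomologous_def DL_coboundaries_2[OF G V rep] by blast
    with F.section_shift(3)[OF f]
    have "ext_cocycle G F (\<lambda>x. t x + inc F (f x)) - ext_cocycle G F t = ext_cocycle G E s - ext_cocycle G F t"
      unfolding ExtD(2)[OF F t] by (simp only:)
    then have "ext_cocycle G F (\<lambda>x. t x + inc F (f x)) = (cochain2 E.\<psi>, cochain1 E.\<chi>)"
      unfolding E.ext_cocycle_eq by simp
    \<comment> \<open>E and F may have different carrier types; the twisted product of the common
      cocycle mediates between them.\<close>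
    then have "ext_iso (twisted G sV dV \<rho> E.\<psi> E.\<chi>) F"
      by (rule ext_iso_twisted_cocycle[OF F F.section_shift(1)[OF f]])
    with ext_iso_sym[OF ext_iso_twisted_cocycle[OF E s E.ext_cocycle_eq]] show "ext_iso E F"
      by (rule ext_iso_trans)
  }
qed

lemma realize_cocycle:
  assumes "c \<in> Z"
  obtains F :: "('k, 'v, 'g, 'v \<times> 'g) extension" where "F \<in> Ext" "cls F = coh `` {c}"
proof -
  obtain \<psi> \<chi> where c: "c = (cochain2 \<psi>, cochain1 \<chi>)" and p: "cocycle_pair lam G sV dV \<rho> \<psi> \<chi>"
    using assms unfolding DL_cocycles_2_iff[OF G V rep] by blast
  interpret twisting lam G sV dV \<rho> \<psi> \<chi>
    by (intro twisting.intro G V rep p)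
  have T: "T \<in> Ext"
    using twisted_extension twisted_section twisted_action
    unfolding extensions_inducing_def induces_def by blast
  show thesis
    using that[OF T] ext_cocycle_class[OF T twisted_section] by (simp add: twisted_cocycle c)
qed

text \<open>It shows that restricting to the carrier \<open>'v \<times> 'g\<close> in
  \<open>class_bij\<close> loses no isomorphism class. The copy is the extension realizing the
  cocycle of E.\<close>

lemma ext_iso_product_carrier:
  assumes E: "E \<in> Ext"
  shows "\<exists>F \<in> Ext :: ('k, 'v, 'g, 'v \<times> 'g) extension set. ext_iso E F"
proof -
  obtain s where s: "is_section G E s" using Ext_section[OF E] .
  obtain F :: "('k, 'v, 'g, 'v \<times> 'g) extension" where F: "F \<in> Ext" "cls F = cls E"
    using realize_cocycle[OF ext_cocycle_cocycle[OF E s]] ext_cocycle_class[OF E s] by metis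
  then show ?thesis using ext_iso_iff_class[OF E F(1)] by auto
qed

lemma equiv_ext_iso_rel: "equiv Ext (ext_iso_rel Ext)"
proof (rule equivI)
  show "refl_on Ext (ext_iso_rel Ext)"
    unfolding refl_on_def ext_iso_rel_def extensions_inducing_def using ext_iso_refl by blast
  show "sym (ext_iso_rel Ext)"
    unfolding sym_def ext_iso_rel_def using ext_iso_sym by blast
  show "trans (ext_iso_rel Ext)"
    unfolding trans_def ext_iso_rel_def using ext_iso_trans by blast
  show "ext_iso_rel Ext \<subseteq> Ext \<times> Ext"
    unfolding ext_iso_rel_def by blast
qed

lemma class_bij:
  "bij_betw (\<lambda>X. the_elem (cls ` X))
     ((Ext :: ('k, 'v, 'g, 'v \<times> 'g) extension set) // ext_iso_rel Ext) (DL_cohomology lam G sV dV \<rho> 2)"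
proof -
  let ?r = "ext_iso_rel (Ext :: ('k, 'v, 'g, 'v \<times> 'g) extension set)"
  \<comment> \<open>The class is constant on isomorphism classes, so \<open>the_elem\<close> is
    applied to a singleton.\<close>
  have val: "the_elem (cls ` (?r `` {E})) = cls E" if "E \<in> Ext" for E
  proof -
    have "cls ` (?r `` {E}) = {cls E}"
      using that ext_iso_iff_class equiv_class_self[OF equiv_ext_iso_rel that]
      by (auto simp: ext_iso_rel_def)
    then show ?thesis by simp
  qed
  show ?thesis
  proof (rule bij_betw_imageI)
    show "inj_on (\<lambda>X. the_elem (cls ` X)) (Ext // ?r)"
    proof (rule inj_onI)
      fix X Y assume "X \<in> Ext // ?r" "Y \<in> Ext // ?r"
        and eq: "the_elem (cls ` X) = the_elem (cls ` Y)"
      then obtain E F where X: "X = ?r `` {E}" "E \<in> Ext" and Y: "Y = ?r `` {F}" "F \<in> Ext"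
        by (auto elim!: quotientE)
      with eq have "cls E = cls F" by (simp only: val)
      then have "(E, F) \<in> ?r" using ext_iso_iff_class X(2) Y(2) by (auto simp: ext_iso_rel_def)
      then show "X = Y" unfolding X(1) Y(1) by (rule equiv_class_eq[OF equiv_ext_iso_rel])
    qed
    show "(\<lambda>X. the_elem (cls ` X)) ` (Ext // ?r) = DL_cohomology lam G sV dV \<rho> 2"
    proof (intro equalityI subsetI)
      fix C assume "C \<in> (\<lambda>X. the_elem (cls ` X)) ` (Ext // ?r)"
      then obtain E :: "('k, 'v, 'g, 'v \<times> 'g) extension" where E: "E \<in> Ext" "C = cls E"
        by (auto elim!: quotientE simp: val)
      obtain s where s: "is_section G E s" using Ext_section[OF E(1)] .
      show "C \<in> DL_cohomology lam G sV dV \<rho> 2"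
        unfolding DL_cohomology_def E(2) ext_cocycle_class[OF E(1) s, symmetric]
        by (rule quotientI[OF ext_cocycle_cocycle[OF E(1) s]])
    next
      fix C assume "C \<in> DL_cohomology lam G sV dV \<rho> 2"
      then obtain c where "c \<in> Z" "C = coh `` {c}"
        unfolding DL_cohomology_def by (auto elim!: quotientE)
      then obtain F :: "('k, 'v, 'g, 'v \<times> 'g) extension" where F: "F \<in> Ext" "cls F = C"
        using realize_cocycle by metis
      then have "C = the_elem (cls ` (?r `` {F}))" by (simp add: val)
      then show "C \<in> (\<lambda>X. the_elem (cls ` X)) ` (Ext // ?r)"
        using quotientI[OF F(1), of ?r] by blast
    qed
  qed
qed

end

theorem theorem2p5:
  fixes lam :: "'k::field_char_0"
    and G :: "('k, 'g::ab_group_add) diff_lie"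
    and sV :: "'k \<Rightarrow> 'v::ab_group_add \<Rightarrow> 'v"
    and dV :: "'v \<Rightarrow> 'v"
  assumes "diff_lie_algebra lam G"
    and "vector_space sV"
    and "Vector_Spaces.linear sV sV dV"
  shows
    "(\<forall>E :: ('k, 'v, 'g, 'e::ab_group_add) extension.
       abelian_extension lam G sV dV E \<longrightarrow>
         (\<exists>!\<rho>. induces G E \<rho>) \<and> (\<forall>\<rho>. induces G E \<rho> \<longrightarrow> diff_representation lam G sV dV \<rho>)) \<and>
     (\<forall>(E :: ('k, 'v, 'g, 'e) extension) (F :: ('k, 'v, 'g, 'f::ab_group_add) extension) \<rho>.
       abelian_extension lam G sV dV E \<longrightarrow> abelian_extension lam G sV dV F \<longrightarrow> ext_iso E F \<longrightarrow>
         (induces G E \<rho> \<longleftrightarrow> induces G F \<rho>)) \<and>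
     (\<forall>\<rho>. diff_representation lam G sV dV \<rho> \<longrightarrow>
       (\<forall>E \<in> extensions_inducing lam G sV dV \<rho> :: ('k, 'v, 'g, 'e) extension set.
          \<forall>s. is_section G E s \<longrightarrow>
            ext_cocycle G E s \<in> DL_cocycles lam G sV dV \<rho> 2 \<and>
            DL_cohomologous lam G sV dV \<rho> 2 `` {ext_cocycle G E s} = ext_class lam G sV dV \<rho> E) \<and>
       (\<forall>E \<in> extensions_inducing lam G sV dV \<rho> :: ('k, 'v, 'g, 'e) extension set.
        \<forall>F \<in> extensions_inducing lam G sV dV \<rho> :: ('k, 'v, 'g, 'f) extension set.
          ext_iso E F \<longleftrightarrow> ext_class lam G sV dV \<rho> E = ext_class lam G sV dV \<rho> F) \<and>
       (\<forall>E \<in> extensions_inducing lam G sV dV \<rho> :: ('k, 'v, 'g, 'e) extension set.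
        \<exists>F \<in> extensions_inducing lam G sV dV \<rho> :: ('k, 'v, 'g, 'v \<times> 'g) extension set.
          ext_iso E F) \<and>
       equiv (extensions_inducing lam G sV dV \<rho> :: ('k, 'v, 'g, 'v \<times> 'g) extension set)
         (ext_iso_rel (extensions_inducing lam G sV dV \<rho>)) \<and>
       bij_betw (\<lambda>X. the_elem (ext_class lam G sV dV \<rho> ` X))
         ((extensions_inducing lam G sV dV \<rho> :: ('k, 'v, 'g, 'v \<times> 'g) extension set)
            // ext_iso_rel (extensions_inducing lam G sV dV \<rho>))
         (DL_cohomology lam G sV dV \<rho> 2))"
proof (intro conjI allI impI ballI)
  fix E :: "('k, 'v, 'g, 'e) extension"
  assume E: "abelian_extension lam G sV dV E"
  show "\<exists>!\<rho>. induces G E \<rho>" by (rule induced_representation(1)[OF assms E])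
  show "diff_representation lam G sV dV \<rho>" if "induces G E \<rho>" for \<rho>
    using that by (rule induced_representation(2)[OF assms E])
next
  fix E :: "('k, 'v, 'g, 'e) extension" and F :: "('k, 'v, 'g, 'f) extension" and \<rho>
  assume E: "abelian_extension lam G sV dV E" and F: "abelian_extension lam G sV dV F"
    and iso: "ext_iso E F"
  show "induces G E \<rho> \<longleftrightarrow> induces G F \<rho>"
    \<comment> \<open>The converse is the same lemma for the inverse isomorphism, with E and F
      exchanged.\<close>
    using induces_ext_iso[OF assms E F iso] induces_ext_iso[OF assms F E ext_iso_sym[OF iso]] by (rule iffI)
next
  fix \<rho>
  assume "diff_representation lam G sV dV \<rho>"
  then interpret diff_lie_representation lam G sV dV \<rho>
    using assms(1,2) by (intro diff_lie_representation.intro)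
  show "ext_cocycle G E s \<in> Z" "coh `` {ext_cocycle G E s} = cls E"
    if "E \<in> Ext" "is_section G E s" for E :: "('k, 'v, 'g, 'e) extension" and s
    using that by (fact ext_cocycle_cocycle ext_cocycle_class)+
  show "ext_iso E F \<longleftrightarrow> cls E = cls F" if "E \<in> Ext" "F \<in> Ext"
    for E :: "('k, 'v, 'g, 'e) extension" and F :: "('k, 'v, 'g, 'f) extension"
    using that by (rule ext_iso_iff_class)
  show "\<exists>F \<in> Ext :: ('k, 'v, 'g, 'v \<times> 'g) extension set. ext_iso E F" if "E \<in> Ext"
    for E :: "('k, 'v, 'g, 'e) extension"
    using that by (rule ext_iso_product_carrier)
  show "equiv (Ext :: ('k, 'v, 'g, 'v \<times> 'g) extension set) (ext_iso_rel Ext)"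
    by (rule equiv_ext_iso_rel)
  show "bij_betw (\<lambda>X. the_elem (cls ` X))
     ((Ext :: ('k, 'v, 'g, 'v \<times> 'g) extension set) // ext_iso_rel Ext) (DL_cohomology lam G sV dV \<rho> 2)"
    by (rule class_bij)
qed

end
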